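(* For all $\delta>0$ there exists $t_0>0$ such that for all $t\ge t_0$ and all $\ell\in\mathcal{C}^\delta$, the fiber $\mathcal{L}_t^{-1}(\ell)\subset AN$ intersects every chamber of $AN_{\mathbb{R}}$ exactly once (i.e. in exactly one point).
   Context: Fix $n\ge 1$, $m=n(n-1)/2$; $n+m$ is the number of pairs $(i,k)$ with $1\le i\le k\le n$. $AN\subset\mathrm{GL}_n(\mathbb{C})$ is the group of upper triangular matrices with positive real diagonal entries, and $AN_{\mathbb{R}}$ is the subset of matrices in $AN$ with real entries. For a Hermitian matrix $H$, $\lambda_1^{(k)}(H)\ge\dots\ge\lambda_k^{(k)}(H)$ are the eigenvalues of its bottom-right $k\times k$ submatrix. For $t>0$, $\mathcal{L}_t\colon AN\to\mathbb{R}^{n+m}$ is the map with components $\frac1t\ln\big(\prod_{j=1}^i\lambda_j^{(k)}(bb^* )\big)$, $1\le i\le k\le n$. For $\delta>0$, $\mathcal{C}^\delta\subset\mathbb{R}^{n+m}$ is the set of $\ell=(\ell_i^{(k)})_{1\le i\le k\le n}$ with $\ell_i^{(k+1)}+\ell_{i-1}^{(k)}>\ell_{i-1}^{(k+1)}+\ell_i^{(k)}+\delta$ and $\ell_i^{(k+1)}+\ell_i^{(k)}>\ell_{i+1}^{(k+1)}+\ell_{i-1}^{(k)}+\delta$ for $1\le i\le k<n$, where $\ell_0^{(k)}=0$. For $1\le i\le k\le n$, $\Delta_i^{(k)}$ is the minor with rows $n-k+1,\dots,n-k+i$ and the last $i$ columns. The hypersurfaces $\Delta_i^{(k)}=0$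 ($1\le i<k\le n$) divide $AN_{\mathbb{R}}$ into chambers: a chamber is the set of $b\in AN_{\mathbb{R}}$ on which all $\Delta_i^{(k)}(b)$, $1\le i<k\le n$, are nonzero with prescribed signs. *)

theory Defs
  imports
    Complex_Main
    "HOL-Library.FuncSet"
    "HOL-Computational_Algebra.Computational_Algebra"
    "Jordan_Normal_Form.Schur_Decomposition"
    "Jordan_Normal_Form.DL_Submatrix"
begin

text \<open>
  Matrix rows and columns are numbered from 0, as in the matrix library. The upper and lower
  indices of eigenvalues, minors and coordinates keep the mathematical range
  \<open>1 \<le> i \<le> k \<le> n\<close>; the pair \<open>(i, k)\<close> stands for lower index \<open>i\<close> and upper index \<open>(k)\<close>.
\<close>

definition tri_idx :: "nat \<Rightarrow> (nat \<times> nat) set" where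
  "tri_idx n = {(i, k). 1 \<le> i \<and> i \<le> k \<and> k \<le> n}"

definition strict_tri_idx :: "nat \<Rightarrow> (nat \<times> nat) set" where
  "strict_tri_idx n = {(i, k). 1 \<le> i \<and> i < k \<and> k \<le> n}"

text \<open>The space \<open>\<real>\<^bsup>n+m\<^esup>\<close>, with coordinates labelled by the \<open>n + m\<close> pairs in \<open>tri_idx n\<close>.\<close>

definition tri_space :: "nat \<Rightarrow> (nat \<times> nat \<Rightarrow> real) set" where
  "tri_space n = tri_idx n \<rightarrow>\<^sub>E UNIV"

definition AN :: "nat \<Rightarrow> complex mat set" where
  "AN n = {b \<in> carrier_mat n n. upper_triangular b \<and>
             (\<forall>j<n. b $$ (j, j) \<in> \<real> \<and> Re (b $$ (j, j)) > 0)}"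

definition AN_real :: "nat \<Rightarrow> complex mat set" where
  "AN_real n = {b \<in> AN n. elements_mat b \<subseteq> \<real>}"

definition bottom_right :: "nat \<Rightarrow> 'a mat \<Rightarrow> 'a mat" where
  "bottom_right k H =
     submatrix H {dim_row H - k..<dim_row H} {dim_col H - k..<dim_col H}"

text \<open>
  Eigenvalues with algebraic multiplicity, in weakly decreasing order. Intended for Hermitian
  matrices only, where \<open>Re\<close> merely converts the (real) eigenvalues to type \<open>real\<close>.
\<close>

definition eigenvalues_desc :: "complex mat \<Rightarrow> real list" where
  "eigenvalues_desc H = rev (sorted_list_of_multiset (image_mset Re (proots (char_poly H))))"

definition lam :: "nat \<Rightarrow> nat \<Rightarrow> complex mat \<Rightarrow> real" where
  "lam i k H = eigenvalues_desc (bottom_right k H) ! (i - 1)"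

definition L_map :: "nat \<Rightarrow> real \<Rightarrow> complex mat \<Rightarrow> (nat \<times> nat \<Rightarrow> real)" where
  "L_map n t b =
     (\<lambda>(i, k) \<in> tri_idx n. 1 / t * ln (\<Prod>j = 1..i. lam j k (b * mat_adjoint b)))"

text \<open>The fibre over \<open>l\<close> of \<open>L_map n t\<close>, viewed as a map with domain \<open>AN n\<close>.\<close>

definition L_fiber :: "nat \<Rightarrow> real \<Rightarrow> (nat \<times> nat \<Rightarrow> real) \<Rightarrow> complex mat set" where
  "L_fiber n t l = {b \<in> AN n. L_map n t b = l}"

text \<open>Coordinate access with the convention that coordinates with lower index 0 vanish.\<close>

definition coord :: "(nat \<times> nat \<Rightarrow> real) \<Rightarrow> nat \<Rightarrow> nat \<Rightarrow> real" where
  "coord l i k = (if i = 0 then 0 else l (i, k))"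

definition C_cone :: "nat \<Rightarrow> real \<Rightarrow> (nat \<times> nat \<Rightarrow> real) set" where
  "C_cone n \<delta> = {l \<in> tri_space n. \<forall>i k. 1 \<le> i \<and> i \<le> k \<and> k < n \<longrightarrow>
     coord l i (k + 1) + coord l (i - 1) k > coord l (i - 1) (k + 1) + coord l i k + \<delta> \<and>
     coord l i (k + 1) + coord l i k > coord l (i + 1) (k + 1) + coord l (i - 1) k + \<delta>}"

text \<open>
  With rows and columns numbered from 1, the minor of an \<open>n \<times> n\<close> matrix with rows
  \<open>n - k + 1, \<dots>, n - k + i\<close> and columns \<open>n - i + 1, \<dots>, n\<close>.
\<close>

definition Delta_minor :: "nat \<Rightarrow> nat \<Rightarrow> 'a :: comm_ring_1 mat \<Rightarrow> 'a" where
  "Delta_minor i k b =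
     det (submatrix b {dim_row b - k..<dim_row b - k + i} {dim_col b - i..<dim_col b})"

text \<open>
  The chamber with sign pattern \<open>\<sigma>\<close>, where \<open>\<sigma>\<close> takes values in \<open>{-1, 1}\<close>. The minors are real on
  \<open>AN_real n\<close>, so \<open>Re\<close> is again only a type conversion.
\<close>

definition chamber :: "nat \<Rightarrow> (nat \<times> nat \<Rightarrow> real) \<Rightarrow> complex mat set" where
  "chamber n \<sigma> = {b \<in> AN_real n. \<forall>(i, k) \<in> strict_tri_idx n.
     Delta_minor i k b \<noteq> 0 \<and> sgn (Re (Delta_minor i k b)) = \<sigma> (i, k)}"

definition chambers :: "nat \<Rightarrow> complex mat set set" where
  "chambers n = {chamber n \<sigma> | \<sigma>. \<sigma> \<in> strict_tri_idx n \<rightarrow>\<^sub>E {-1, 1}}"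

end

theory Submission
  imports Defs
begin

text \<open>
  A matrix of \<open>AN_real n\<close> is built up from its bottom right corner: the block of size \<open>k + 1\<close>
  arises from the block \<open>B\<close> of size \<open>k\<close> by adding one row on top, that is, a vector \<open>r\<close> and a
  positive diagonal entry \<open>d\<close>. Write \<open>B = U diag(sqrt mu) V\<^sup>T\<close> and \<open>r = sum s\<^sub>j v\<^sub>j\<close> in the right
  singular vectors. In the eigenbasis of \<open>B B\<^sup>T\<close> the new Gram matrix is an arrowhead matrix, and its
  secular equation shows that prescribing the new spectrum \<open>nu\<close> is the same as prescribing \<open>d\<close> and
  all squares \<open>s\<^sub>j\<^sup>2\<close>, while the signs of the \<open>s\<^sub>j\<close> stay free
  (\<open>secular_imp_weight\<close>, \<open>arrow_exists\<close>, \<open>spectrum_imp_secular\<close>). So the real points of a fibre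
  are counted by one sign for each new row and each singular vector, which is as many signs as there
  are minors \<open>\<Delta>\<^sub>i\<^bsup>(k)\<^esup>\<close> with \<open>i < k\<close>. It remains to see that for strongly interlacing spectra the signs of the
  minors of the new block determine the signs of the \<open>s\<^sub>j\<close>, and conversely.

  The singular vectors of the new block are explicit: they are those of \<open>B\<close>, extended by the new
  coordinate and rotated by orthogonal matrices \<open>X\<close> and \<open>Y\<close> (\<open>svd_step\<close>). If consecutive
  spectra interlace with ratios at most \<open>eps\<close>, then up to an error of order \<open>sqrt eps\<close> the
  matrix \<open>X\<close> is a cyclic shift and \<open>Y\<close> is diagonal, both with signs that are read off from the
  \<open>s\<^sub>j\<close>. By induction \<open>U\<close> is close to a signed antidiagonal matrix and \<open>V\<close> to a signed diagonal
  one (\<open>near_step\<close>), in the row order explained next. A corner minor of \<open>U diag(sqrt mu) V\<^sup>T\<close> has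
  then the sign of the product of the dominant entries (\<open>sgn_minor\<close>). Comparing two consecutive
  sizes, the squares \<open>(sgn s\<^sub>p)\<^sup>2\<close> with \<open>p < m\<close> drop out and the sign of the minor of order \<open>m + 1\<close>
  equals \<open>sgn s\<^sub>m\<close> times a sign depending only on the smaller block (\<open>sgn_minor_step\<close>). Existence
  and uniqueness follow by induction on the size of the block.

  Real matrices are functions \<open>nat \<Rightarrow> nat \<Rightarrow> real\<close> whose rows and columns are counted from the
  bottom right corner, so that upper triangular matrices become lower triangular, the block of size
  \<open>k\<close> consists of the entries with both indices below \<open>k\<close>, and a new row gets the index \<open>k\<close>.
  Eigenvalues are numbered in decreasing order starting with 0.

  The quantitative input is \<open>eps\<close>, which bounds \<open>exp (- t \<delta>)\<close>: an element of the cone gives spectra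
  \<open>exp (t (l\<^sub>i - l\<^bsub>i-1\<^esub>))\<close> that interlace with this ratio (\<open>C_cone_separated\<close>), so a large \<open>t\<close> makes all
  estimates available uniformly in \<open>l\<close>.
\<close>

section \<open>Orthogonal matrices\<close>

definition ortho :: "nat \<Rightarrow> (nat \<Rightarrow> nat \<Rightarrow> real) \<Rightarrow> bool" where
  "ortho k U \<longleftrightarrow> (\<forall>i<k. \<forall>j<k. (\<Sum>p<k. U p i * U p j) = of_bool (i = j))"

text \<open>
  A left inverse of a square matrix is also a right inverse.
\<close>

lemma ortho_rows:
  assumes "ortho k U" "p < k" "q < k"
  shows "(\<Sum>i<k. U p i * U q i) = of_bool (p = q)"
proof -
  define M where "M = mat k k (\<lambda>(p, i). U p i)"
  have M: "M \<in> carrier_mat k k" "transpose_mat M \<in> carrier_mat k k"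
    by (auto simp: M_def)
  have "transpose_mat M * M = 1\<^sub>m k"
    using assms(1)
    by (intro eq_matI) (auto simp: M_def ortho_def scalar_prod_def atLeast0LessThan)
  then have "M * transpose_mat M = 1\<^sub>m k"
    using mat_mult_left_right_inverse[OF M(2,1)] by simp
  then have "(M * transpose_mat M) $$ (p, q) = (1\<^sub>m k :: real mat) $$ (p, q)" by simp
  then show ?thesis
    using assms(2,3) by (simp add: M_def scalar_prod_def atLeast0LessThan)
qed

lemma ortho_row_expansion:
  assumes "ortho k U" "q < k"
  shows "(\<Sum>j<k. (\<Sum>p<k. r p * U p j) * U q j) = r q"
proof -
  have "(\<Sum>j<k. (\<Sum>p<k. r p * U p j) * U q j) = (\<Sum>j<k. \<Sum>p<k. r p * (U p j * U q j))"
    by (simp add: sum_distrib_right mult.assoc)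
  also have "\<dots> = (\<Sum>p<k. r p * (\<Sum>j<k. U p j * U q j))"
    by (subst sum.swap) (simp add: sum_distrib_left)
  also have "\<dots> = (\<Sum>p<k. r p * of_bool (p = q))"
    using assms by (intro sum.cong refl) (simp add: ortho_rows)
  also have "\<dots> = r q" using assms(2) by (simp add: of_bool_def if_distrib cong: if_cong)
  finally show ?thesis .
qed

lemma ortho_inner:
  assumes "ortho k U"
  shows "(\<Sum>p<k. (\<Sum>j<k. U p j * x j) * (\<Sum>l<k. U p l * y l)) = (\<Sum>j<k. x j * y j)"
proof -
  have "(\<Sum>p<k. (\<Sum>j<k. U p j * x j) * (\<Sum>l<k. U p l * y l))
      = (\<Sum>p<k. \<Sum>j<k. \<Sum>l<k. x j * y l * (U p j * U p l))"
    by (simp add: sum_product mult_ac)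
  also have "\<dots> = (\<Sum>j<k. \<Sum>p<k. \<Sum>l<k. x j * y l * (U p j * U p l))"
    by (rule sum.swap)
  also have "\<dots> = (\<Sum>j<k. \<Sum>l<k. \<Sum>p<k. x j * y l * (U p j * U p l))"
    by (intro sum.cong refl sum.swap)
  also have "\<dots> = (\<Sum>j<k. \<Sum>l<k. x j * y l * of_bool (j = l))"
    using assms by (intro sum.cong refl) (simp add: ortho_def flip: sum_distrib_left)
  also have "\<dots> = (\<Sum>j<k. x j * y j)"
    by (intro sum.cong refl) (simp add: of_bool_def if_distrib cong: if_cong)
  finally show ?thesis .
qed

text \<open>
  The product of \<open>diag(U, 1)\<close> with the \<open>(k + 1) \<times> (k + 1)\<close> matrix whose last row is \<open>x0\<close> and whose
  upper rows are \<open>x\<close>. All singular vectors below are produced in this form.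
\<close>

definition bordered :: "nat \<Rightarrow> (nat \<Rightarrow> nat \<Rightarrow> real) \<Rightarrow> (nat \<Rightarrow> real) \<Rightarrow> (nat \<Rightarrow> nat \<Rightarrow> real)
    \<Rightarrow> nat \<Rightarrow> nat \<Rightarrow> real" where
  "bordered k U x0 x p i = (if p = k then x0 i else \<Sum>j<k. U p j * x j i)"

lemma ortho_bordered:
  assumes "ortho k U"
    and "\<And>i l. i < Suc k \<Longrightarrow> l < Suc k \<Longrightarrow> x0 i * x0 l + (\<Sum>j<k. x j i * x j l) = of_bool (i = l)"
  shows "ortho (Suc k) (bordered k U x0 x)"
  unfolding ortho_def
proof (intro allI impI)
  fix i l assume il: "i < Suc k" "l < Suc k"
  have "(\<Sum>p<k. bordered k U x0 x p i * bordered k U x0 x p l)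
      = (\<Sum>p<k. (\<Sum>j<k. U p j * x j i) * (\<Sum>j<k. U p j * x j l))"
    by (intro sum.cong refl) (simp add: bordered_def)
  also have "\<dots> = (\<Sum>j<k. x j i * x j l)" by (rule ortho_inner[OF assms(1)])
  finally show "(\<Sum>p<Suc k. bordered k U x0 x p i * bordered k U x0 x p l) = of_bool (i = l)"
    using assms(2)[OF il] by (simp add: bordered_def)
qed

lemma ortho_abs_le_1:
  assumes "ortho k U" "p < k" "i < k" shows "\<bar>U p i\<bar> \<le> 1"
proof -
  have "U p i * U p i \<le> (\<Sum>p<k. U p i * U p i)"
    using assms(2) by (intro member_le_sum) auto
  also have "\<dots> = 1" using assms by (simp add: ortho_def)
  finally have "(U p i)\<^sup>2 \<le> 1" by (simp add: power2_eq_square)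
  then show ?thesis by (simp add: abs_square_le_1)
qed

text \<open>
  When all other coordinates of a unit vector are small, the remaining one carries at least three
  quarters of the squared length.
\<close>

lemma unit_vector_dominant:
  fixes f :: "'b \<Rightarrow> real"
  assumes "finite A" "p \<in> A" "(\<Sum>q\<in>A. f q * f q) = 1"
    and small: "\<And>q. q \<in> A \<Longrightarrow> q \<noteq> p \<Longrightarrow> \<bar>f q\<bar> \<le> e" and e: "0 \<le> e" "real (card A) * e \<le> 1 / 4"
  shows "1 / 2 \<le> \<bar>f p\<bar>"
proof -
  have "1 \<le> card A" using assms(1,2) by (simp add: Suc_le_eq card_gt_0_iff) blast
  then have "1 * e \<le> real (card A) * e" using e by (intro mult_right_mono) auto
  then have e4: "e \<le> 1 / 4" using e by simp
  have "f q * f q \<le> e * e" if "q \<in> A - {p}" for q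
    using small[of q] that e by (metis Diff_iff abs_mult_self_eq abs_ge_zero insertCI mult_mono)
  then have "(\<Sum>q\<in>A-{p}. f q * f q) \<le> (\<Sum>q\<in>A-{p}. e * e)"
    by (intro sum_mono)
  also have "\<dots> \<le> real (card A) * (e * e)"
    using assms(1,2) by (simp add: mult_right_mono)
  also have "\<dots> = real (card A) * e * e" by simp
  also have "\<dots> \<le> 1 / 4 * e" using e by (intro mult_right_mono)
  finally have "(\<Sum>q\<in>A-{p}. f q * f q) \<le> 1 / 4" using e4 by simp
  moreover have "(\<Sum>q\<in>A. f q * f q) = f p * f p + (\<Sum>q\<in>A-{p}. f q * f q)"
    using assms(1,2) by (rule sum.remove)
  ultimately have "(1/2)\<^sup>2 \<le> \<bar>f p\<bar>\<^sup>2" using assms(3) by (simp add: power2_eq_square)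
  then show ?thesis by (rule power2_le_imp_le) simp
qed

lemma ortho_diag_ge_half:
  assumes "ortho k U" "p < k" "i < k" "0 \<le> e" "real k * e \<le> 1 / 4"
    and "\<And>q. q < k \<Longrightarrow> q \<noteq> p \<Longrightarrow> \<bar>U q i\<bar> \<le> e"
  shows "1 / 2 \<le> \<bar>U p i\<bar>"
  by (rule unit_vector_dominant[of "{..<k}" p "\<lambda>q. U q i" e]) (use assms in \<open>auto simp: ortho_def\<close>)

lemma ortho_column_coeff:
  assumes "ortho k U" "l < k"
  shows "(\<Sum>p<k. U p l * (\<Sum>j<k. U p j * c j)) = c l"
proof -
  have "(\<Sum>p<k. U p l * (\<Sum>j<k. U p j * c j)) = (\<Sum>p<k. \<Sum>j<k. c j * (U p l * U p j))"
    by (simp add: sum_distrib_left mult_ac)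
  also have "\<dots> = (\<Sum>j<k. \<Sum>p<k. c j * (U p l * U p j))"
    by (rule sum.swap)
  also have "\<dots> = (\<Sum>j<k. c j * of_bool (l = j))"
    using assms by (intro sum.cong refl) (simp add: ortho_def flip: sum_distrib_left)
  also have "\<dots> = c l" using assms(2) by (simp add: of_bool_def if_distrib cong: if_cong)
  finally show ?thesis .
qed

section \<open>The secular equation of an arrowhead matrix\<close>

text \<open>
  The characteristic polynomial of the arrowhead matrix with diagonal \<open>mu\<^sub>0, ..., mu\<^bsub>k-1\<^esub>, a\<close> and
  border entries whose squares are \<open>p\<^sub>j\<close>.
\<close>

definition arrow_fun :: "nat \<Rightarrow> (nat \<Rightarrow> real) \<Rightarrow> real \<Rightarrow> (nat \<Rightarrow> real) \<Rightarrow> real \<Rightarrow> real" where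
  "arrow_fun k mu a p x =
     (x - a) * (\<Prod>j<k. x - mu j) - (\<Sum>j<k. p j * (\<Prod>l\<in>{..<k}-{j}. x - mu l))"

lemma monic_prod:
  fixes f :: "'b \<Rightarrow> real"
  assumes "finite A"
  shows "degree (\<Prod>j\<in>A. [:- f j, 1:]) = card A" "Polynomial.coeff (\<Prod>j\<in>A. [:- f j, 1:]) (card A) = 1"
proof -
  show *: "degree (\<Prod>j\<in>A. [:- f j, 1:]) = card A"
    by (subst degree_prod_eq_sum_degree) auto
  have "lead_coeff (\<Prod>j\<in>A. [:- f j, 1:]) = 1" by (subst lead_coeff_prod) auto
  then show "Polynomial.coeff (\<Prod>j\<in>A. [:- f j, 1:]) (card A) = 1" by (simp only: *)
qed

text \<open>
  Both sides are monic polynomials of degree \<open>k + 1\<close>, so their difference has degree at most \<open>k\<close> and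
  cannot have \<open>k + 1\<close> roots unless it vanishes.
\<close>

lemma arrow_fun_eqI:
  assumes S: "finite S" "card S = Suc k"
    and eq: "\<And>x. x \<in> S \<Longrightarrow> arrow_fun k mu a p x = (\<Prod>i<Suc k. x - nu i)"
  shows "arrow_fun k mu a p x = (\<Prod>i<Suc k. x - nu i)"
proof -
  define P where "P = [:- a, 1:] * (\<Prod>j<k. [:- mu j, 1:])"
  define R where "R = (\<Sum>j<k. Polynomial.smult (p j) (\<Prod>l\<in>{..<k}-{j}. [:- mu l, 1:]))"
  define F where "F = (\<Prod>i<Suc k. [:- nu i, 1:])"
  have pP: "poly (P - R) x = arrow_fun k mu a p x" for x
    by (simp add: P_def R_def arrow_fun_def poly_prod poly_sum algebra_simps)
  have pF: "poly F x = (\<Prod>i<Suc k. x - nu i)" for x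
    unfolding F_def poly_prod by simp
  have "P = (\<Prod>i<Suc k. [:- (if i = k then a else mu i), 1:])"
    unfolding P_def by (simp add: mult.commute)
  then have P: "degree P = Suc k" "Polynomial.coeff P (Suc k) = 1"
    using monic_prod[of "{..<Suc k}" "\<lambda>i. if i = k then a else mu i"] by (simp_all only: card_lessThan finite_lessThan)
  have F: "degree F = Suc k" "Polynomial.coeff F (Suc k) = 1"
    using monic_prod[of "{..<Suc k}" nu] unfolding F_def by (simp_all only: card_lessThan finite_lessThan)
  have R: "degree R \<le> k"
    unfolding R_def
    by (intro degree_sum_le) (auto intro!: order.trans[OF degree_smult_le] simp: monic_prod)
  have 1: "degree (P - R - F) \<le> Suc k"
    using P F R by (intro degree_diff_le) auto
  have 2: "Polynomial.coeff (P - R - F) (Suc k) = 0"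
    using P F R by (simp add: coeff_eq_0)
  have deg: "degree (P - R - F) < Suc k"
  proof (rule ccontr)
    assume "\<not> ?thesis"
    then have d: "degree (P - R - F) = Suc k" using 1 by simp
    then have "P - R - F \<noteq> 0" by auto
    then show False using d 2 by (metis leading_coeff_0_iff)
  qed
  have "P - R - F = 0"
  proof (rule ccontr)
    assume nz: "P - R - F \<noteq> 0"
    have "S \<subseteq> {x. poly (P - R - F) x = 0}"
      using eq pP pF by (metis (mono_tags, lifting) mem_Collect_eq poly_diff right_minus_eq subsetI)
    then have "card S \<le> card {x. poly (P - R - F) x = 0}"
      by (rule card_mono[OF poly_roots_finite[OF nz]])
    also have "\<dots> \<le> degree (P - R - F)" by (rule card_poly_roots_bound[OF nz])
    finally show False using deg S by simp
  qed
  then show ?thesis using pP pF by (metis right_minus_eq)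
qed

lemma arrow_fun_at_mu:
  assumes "j < k"
  shows "arrow_fun k mu a p (mu j) = - p j * (\<Prod>l\<in>{..<k}-{j}. mu j - mu l)"
proof -
  have 0: "(\<Prod>l<k. mu j - mu l) = 0" using assms by auto
  have "(\<Sum>i<k. p i * (\<Prod>l\<in>{..<k}-{i}. mu j - mu l))
      = p j * (\<Prod>l\<in>{..<k}-{j}. mu j - mu l)
        + (\<Sum>i\<in>{..<k}-{j}. p i * (\<Prod>l\<in>{..<k}-{i}. mu j - mu l))"
    using assms by (intro sum.remove) auto
  also have "(\<Sum>i\<in>{..<k}-{j}. p i * (\<Prod>l\<in>{..<k}-{i}. mu j - mu l)) = 0"
    using assms by (intro sum.neutral) auto
  finally show ?thesis by (simp add: arrow_fun_def 0)
qed

text \<open>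
  The second factor is the secular function, whose zeros are the eigenvalues of the arrowhead matrix.
\<close>

lemma arrow_fun_factor:
  assumes "\<And>j. j < k \<Longrightarrow> x \<noteq> mu j"
  shows "arrow_fun k mu a p x = (\<Prod>j<k. x - mu j) * (x - a - (\<Sum>j<k. p j / (x - mu j)))"
proof -
  have "p j * (\<Prod>l\<in>{..<k}-{j}. x - mu l) = (\<Prod>l<k. x - mu l) * (p j / (x - mu j))" if "j < k" for j
  proof -
    have "(\<Prod>l<k. x - mu l) = (x - mu j) * (\<Prod>l\<in>{..<k}-{j}. x - mu l)"
      using that by (intro prod.remove) auto
    then show ?thesis using assms[OF that] by simp
  qed
  then have "(\<Sum>j<k. p j * (\<Prod>l\<in>{..<k}-{j}. x - mu l))
      = (\<Prod>l<k. x - mu l) * (\<Sum>j<k. p j / (x - mu j))"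
    by (simp add: sum_distrib_left)
  then show ?thesis by (simp add: arrow_fun_def algebra_simps)
qed

section \<open>Strongly interlacing spectra\<close>

text \<open>
  The spectrum \<open>mu\<close> of a block and the spectrum \<open>nu\<close> of the next block interlace,
  \<open>nu\<^sub>0 > mu\<^sub>0 > nu\<^sub>1 > mu\<^sub>1 > ... > nu\<^sub>k\<close>, and each of these numbers is at most \<open>eps\<close> times the preceding one.
\<close>

locale separated =
  fixes k :: nat and mu nu :: "nat \<Rightarrow> real" and eps :: real
  assumes eps: "0 < eps" "eps \<le> 1 / 2"
    and mu_pos: "\<And>j. j < k \<Longrightarrow> 0 < mu j"
    and nu_pos: "\<And>i. i \<le> k \<Longrightarrow> 0 < nu i"
    and mu_le: "\<And>j. j < k \<Longrightarrow> mu j \<le> eps * nu j"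
    and nu_Suc_le: "\<And>j. j < k \<Longrightarrow> nu (Suc j) \<le> eps * mu j"
begin

lemma eps_mult_le: "0 \<le> x \<Longrightarrow> eps * x \<le> x / 2"
  using eps mult_right_mono[of eps "1/2" x] by simp

lemma nu_Suc_le_nu: "j < k \<Longrightarrow> nu (Suc j) \<le> nu j"
  using mu_le[of j] nu_Suc_le[of j] eps_mult_le[of "mu j"] eps_mult_le[of "nu j"] mu_pos[of j] nu_pos[of j]
  by linarith

lemma nu_antimono: "i \<le> j \<Longrightarrow> j \<le> k \<Longrightarrow> nu j \<le> nu i"
proof (induction rule: dec_induct)
  case (step n)
  then show ?case using nu_Suc_le_nu[of n] by simp
qed simp

lemma mu_le_nu: "i \<le> j \<Longrightarrow> j < k \<Longrightarrow> mu j \<le> eps * nu i"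
  using mu_le[of j] nu_antimono[of i j] eps by (smt (verit) less_imp_le mult_left_mono)

lemma nu_le_mu: "j < i \<Longrightarrow> i \<le> k \<Longrightarrow> nu i \<le> eps * mu j"
  using nu_Suc_le[of j] nu_antimono[of "Suc j" i] by simp

lemma mu_le_half_nu: "i \<le> j \<Longrightarrow> j < k \<Longrightarrow> mu j \<le> nu i / 2"
  using mu_le_nu[of i j] eps_mult_le[of "nu i"] nu_pos[of i] by linarith

lemma nu_le_half_mu: "j < i \<Longrightarrow> i \<le> k \<Longrightarrow> nu i \<le> mu j / 2"
  using nu_le_mu[of j i] eps_mult_le[of "mu j"] mu_pos[of j] by linarith

lemma mu_le_half_mu: "j < l \<Longrightarrow> l < k \<Longrightarrow> mu l \<le> mu j / 2"
  using mu_le_half_nu[of l l] nu_le_half_mu[of j l] nu_pos[of l] by simp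

lemma mu_neq: "i < k \<Longrightarrow> j < k \<Longrightarrow> i \<noteq> j \<Longrightarrow> mu i \<noteq> mu j"
  using mu_le_half_mu[of i j] mu_le_half_mu[of j i] mu_pos[of i] mu_pos[of j] by (metis linorder_neq_iff not_le field_sum_of_halves less_add_same_cancel1 half_gt_zero)

lemma nu_neq_mu: "i \<le> k \<Longrightarrow> j < k \<Longrightarrow> nu i \<noteq> mu j"
  using nu_le_half_mu[of j i] mu_le_half_nu[of i j] mu_pos[of j] nu_pos[of i] by (cases "j < i") auto

lemma nu_neq: "i \<le> k \<Longrightarrow> l \<le> k \<Longrightarrow> i \<noteq> l \<Longrightarrow> nu i \<noteq> nu l"
proof (induction i l rule: linorder_wlog)
  case (le i l)
  then show ?case using nu_le_half_mu[of i l] mu_le_half_nu[of i i] nu_pos[of l] mu_pos[of i] by auto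
next
  case (sym a b) then show ?case by metis
qed

text \<open>
  The squared border entry \<open>- prod (mu\<^sub>j - nu\<^sub>i) / prod (mu\<^sub>j - mu\<^sub>l)\<close> of the arrowhead matrix with
  spectrum \<open>nu\<close>, with numerators and denominators paired so that each factor is visibly positive.
\<close>

definition weight :: "nat \<Rightarrow> real" where
  "weight j = (nu j - mu j) * (mu j - nu k) * (\<Prod>l\<in>{..<k}-{j}. (mu j - nu l) / (mu j - mu l))"

text \<open>
  Up to factors bounded in terms of \<open>k\<close>, the weights are \<open>mu\<^sub>j\<^sup>2 gain (j + 1)\<close>, and all sizes that
  occur below are monomials in \<open>mu\<close>, \<open>nu\<close> and \<open>gain\<close>. Two monotonicities are used to compare them:
  from \<open>j\<close> to \<open>j + 1\<close>, \<open>gain j\<close> grows at least by the factor \<open>1 / eps\<close> and \<open>gain j * nu j\<close> shrinks at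
  least by the factor \<open>eps\<close>.
\<close>

definition gain :: "nat \<Rightarrow> real" where "gain j = (\<Prod>l<j. nu l / mu l)"

lemma gain_0: "gain 0 = 1" and gain_Suc: "gain (Suc j) = gain j * (nu j / mu j)"
  by (simp_all add: gain_def)

lemma gain_pos: "j \<le> k \<Longrightarrow> 0 < gain j"
  unfolding gain_def using mu_pos nu_pos by (intro prod_pos) auto

lemma gain_Suc_mu: "j < k \<Longrightarrow> gain (Suc j) * mu j = gain j * nu j"
  using mu_pos[of j] by (simp add: gain_Suc)

lemma gain_step: assumes "j < k" shows "gain j \<le> eps * gain (Suc j)"
proof -
  have "gain j * mu j \<le> gain j * (eps * nu j)"
    using mu_le[OF assms] gain_pos[of j] assms by (intro mult_left_mono) auto
  then show ?thesis using mu_pos[OF assms] by (simp add: gain_Suc field_simps)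
qed

lemma gain_mono: "i \<le> j \<Longrightarrow> j \<le> k \<Longrightarrow> gain i \<le> gain j"
proof (induction rule: dec_induct)
  case (step n)
  then have "gain i \<le> gain n" "gain n \<le> eps * gain (Suc n)" "0 < gain (Suc n)"
    using gain_step[of n] gain_pos[of "Suc n"] by auto
  then show ?case using eps_mult_le[of "gain (Suc n)"] by linarith
qed simp

lemma gain_le: assumes "i < j" "j \<le> k" shows "gain i \<le> eps * gain j"
proof -
  have "gain i \<le> eps * gain (Suc i)" using assms by (intro gain_step) auto
  also have "\<dots> \<le> eps * gain j" using assms eps gain_mono[of "Suc i" j] by simp
  finally show ?thesis .
qed

lemma gain_nu_step: assumes "j < k" shows "gain (Suc j) * nu (Suc j) \<le> eps * (gain j * nu j)"
proof -
  have "gain (Suc j) * nu (Suc j) \<le> gain (Suc j) * (eps * mu j)"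
    using nu_Suc_le[OF assms] gain_pos[of "Suc j"] assms by (intro mult_left_mono) auto
  then show ?thesis using gain_Suc_mu[OF assms] by (simp add: mult_ac)
qed

lemma gain_nu_antimono: "i \<le> j \<Longrightarrow> j \<le> k \<Longrightarrow> gain j * nu j \<le> gain i * nu i"
proof (induction rule: dec_induct)
  case (step n)
  then show ?case using gain_nu_step[of n] gain_pos[of n] nu_pos[of n] eps_mult_le[of "gain n * nu n"]
    by (smt (verit) Suc_leD Suc_le_lessD field_sum_of_halves mult_pos_pos)
qed simp

lemma gain_nu_le: assumes "i < j" "j \<le> k" shows "gain j * nu j \<le> eps * (gain i * nu i)"
  using gain_nu_antimono[of "Suc i" j] gain_nu_step[of i] assms by linarith

text \<open>
  In a difference of two separated numbers the larger one dominates up to a factor 2.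
\<close>

lemma weight_factor_bounds:
  assumes "j < k" "l < k" "l \<noteq> j"
  defines "f \<equiv> (if l < j then nu l / mu l else 1)"
  shows "f / 2 \<le> (mu j - nu l) / (mu j - mu l)" "(mu j - nu l) / (mu j - mu l) \<le> 2 * f"
proof -
  have pos: "0 < mu j" "0 < mu l" "0 < nu l" using assms mu_pos nu_pos by auto
  have "f / 2 \<le> (mu j - nu l) / (mu j - mu l) \<and> (mu j - nu l) / (mu j - mu l) \<le> 2 * f"
  proof (cases "l < j")
    case True
    have 1: "mu j \<le> mu l / 2" "mu j \<le> nu l / 2"
      using True assms mu_le_half_mu[of l j] mu_le_half_nu[of l j] by auto
    have eq: "(mu j - nu l) / (mu j - mu l) = (nu l - mu j) / (mu l - mu j)"
      by (metis minus_diff_eq minus_divide_divide)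
    have "(nu l / 2) / mu l \<le> (nu l - mu j) / (mu l - mu j)"
      using 1 pos by (intro frac_le) auto
    moreover have "(nu l - mu j) / (mu l - mu j) \<le> nu l / (mu l / 2)"
      using 1 pos by (intro frac_le) auto
    ultimately show ?thesis using True unfolding eq f_def by (simp add: mult.commute)
  next
    case False
    then have "j < l" using assms by simp
    then have 1: "mu l \<le> mu j / 2" "nu l \<le> mu j / 2"
      using assms mu_le_half_mu[of j l] nu_le_half_mu[of j l] by auto
    have "(mu j / 2) / mu j \<le> (mu j - nu l) / (mu j - mu l)"
      using 1 pos by (intro frac_le) auto
    moreover have "(mu j - nu l) / (mu j - mu l) \<le> mu j / (mu j / 2)"
      using 1 pos by (intro frac_le) auto
    ultimately show ?thesis using False pos unfolding f_def by simp
  qed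
  then show "f / 2 \<le> (mu j - nu l) / (mu j - mu l)" "(mu j - nu l) / (mu j - mu l) \<le> 2 * f" by auto
qed

lemma weight_bounds:
  assumes "j < k"
  shows "(mu j)\<^sup>2 * gain (Suc j) / 2 ^ Suc k \<le> weight j"
    "weight j \<le> 2 ^ Suc k * ((mu j)\<^sup>2 * gain (Suc j))"
proof -
  define f where "f l = (if l < j then nu l / mu l else 1)" for l
  define g where "g l = (mu j - nu l) / (mu j - mu l)" for l
  define A where "A = {..<k} - {j}"
  have pos: "0 < mu j" "0 < nu j" "0 < nu k" using assms mu_pos nu_pos by auto
  have f: "(\<Prod>l\<in>A. f l) = gain j"
  proof -
    have "(\<Prod>l\<in>A. f l) = (\<Prod>l<j. f l)"
      unfolding A_def using assms by (intro prod.mono_neutral_right) (auto simp: f_def)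
    then show ?thesis by (simp add: f_def gain_def)
  qed
  have fpos: "0 < f l" if "l \<in> A" for l
    using that mu_pos nu_pos by (auto simp: f_def A_def)
  have card: "card A = k - 1" "finite A" using assms by (auto simp: A_def)
  have b: "f l / 2 \<le> g l \<and> g l \<le> 2 * f l" if "l \<in> A" for l
    using weight_factor_bounds[of j l] that assms by (auto simp: A_def g_def f_def)
  have lo: "gain j / 2 ^ (k - 1) \<le> (\<Prod>l\<in>A. g l)"
  proof -
    have "gain j / 2 ^ (k - 1) = (\<Prod>l\<in>A. f l / 2)"
      by (simp add: prod_dividef f card)
    also have "\<dots> \<le> (\<Prod>l\<in>A. g l)" using b fpos by (intro prod_mono) (auto intro: less_imp_le)
    finally show ?thesis .
  qed
  have up: "(\<Prod>l\<in>A. g l) \<le> 2 ^ (k - 1) * gain j"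
  proof -
    have "(\<Prod>l\<in>A. g l) \<le> (\<Prod>l\<in>A. 2 * f l)"
    proof (intro prod_mono conjI)
      fix l assume "l \<in> A"
      then show "0 \<le> g l" "g l \<le> 2 * f l" using b[of l] fpos[of l] by auto
    qed
    also have "\<dots> = 2 ^ (k - 1) * gain j" by (simp add: prod.distrib f card)
    finally show ?thesis .
  qed
  define h where "h = (nu j - mu j) * (mu j - nu k)"
  have w: "weight j = h * (\<Prod>l\<in>A. g l)"
    by (simp add: weight_def h_def g_def A_def)
  have d: "nu j / 2 \<le> nu j - mu j" "nu j - mu j \<le> nu j" "mu j / 2 \<le> mu j - nu k" "mu j - nu k \<le> mu j"
    using mu_le_half_nu[of j j] nu_le_half_mu[of j k] assms pos by auto
  have h: "nu j / 2 * (mu j / 2) \<le> h" "h \<le> nu j * mu j"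
    unfolding h_def using d pos by (intro mult_mono; simp)+
  have gj: "0 < gain j" using assms by (simp add: gain_pos)
  have eq: "(mu j)\<^sup>2 * gain (Suc j) = nu j * mu j * gain j"
    using pos by (simp add: gain_Suc power2_eq_square)
  have k: "(2::real) ^ Suc k = 4 * 2 ^ (k - 1)" using assms by (cases k) auto
  have "(mu j)\<^sup>2 * gain (Suc j) / 2 ^ Suc k = (nu j / 2 * (mu j / 2)) * (gain j / 2 ^ (k - 1))"
    unfolding eq k by simp
  also have "\<dots> \<le> weight j" unfolding w
    using h lo pos gj by (intro mult_mono) (auto intro: order.trans[OF _ h(1)])
  finally show "(mu j)\<^sup>2 * gain (Suc j) / 2 ^ Suc k \<le> weight j" .
  have "weight j \<le> (nu j * mu j) * (2 ^ (k - 1) * gain j)" unfolding w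
  proof (intro mult_mono h up)
    show "0 \<le> prod g A" using lo gj by (smt (verit) divide_nonneg_pos zero_less_power)
  qed (use pos in auto)
  also have "\<dots> \<le> 2 ^ Suc k * (nu j * mu j * gain j)"
    unfolding k using pos gj by simp
  finally show "weight j \<le> 2 ^ Suc k * ((mu j)\<^sup>2 * gain (Suc j))" unfolding eq .
qed

lemma weight_pos: assumes "j < k" shows "0 < weight j"
proof -
  have "0 < (mu j)\<^sup>2 * gain (Suc j) / 2 ^ Suc k"
    using assms mu_pos[of j] gain_pos[of "Suc j"] by simp
  then show ?thesis using weight_bounds(1)[OF assms] by linarith
qed

lemma prod_mu_diff_nonzero: "j < k \<Longrightarrow> (\<Prod>l\<in>{..<k}-{j}. mu j - mu l) \<noteq> 0"
  using mu_neq by auto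

lemma weight_eq:
  assumes "j < k"
  shows "- weight j * (\<Prod>l\<in>{..<k}-{j}. mu j - mu l) = (\<Prod>i<Suc k. mu j - nu i)"
proof -
  have "(\<Prod>i<Suc k. mu j - nu i) = (mu j - nu k) * (\<Prod>i<k. mu j - nu i)" by simp
  also have "(\<Prod>i<k. mu j - nu i) = (mu j - nu j) * (\<Prod>l\<in>{..<k}-{j}. mu j - nu l)"
    using assms by (intro prod.remove) auto
  finally have F: "(\<Prod>i<Suc k. mu j - nu i)
      = (mu j - nu k) * ((mu j - nu j) * (\<Prod>l\<in>{..<k}-{j}. mu j - nu l))" .
  define m where "m = (\<Prod>l\<in>{..<k}-{j}. mu j - mu l)"
  define n where "n = (\<Prod>l\<in>{..<k}-{j}. mu j - nu l)"
  have "m \<noteq> 0" using prod_mu_diff_nonzero[OF assms] by (simp add: m_def)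
  then have "- ((nu j - mu j) * (mu j - nu k) * (n / m)) * m = (mu j - nu k) * ((mu j - nu j) * n)"
    by simp (simp add: algebra_simps)
  then show ?thesis unfolding F weight_def prod_dividef by (fold m_def n_def)
qed

lemma nu_set: "finite (nu ` {..<Suc k})" "card (nu ` {..<Suc k}) = Suc k"
proof -
  have "inj_on nu {..<Suc k}" using nu_neq by (intro inj_onI) (metis lessThan_iff less_Suc_eq_le)
  then show "card (nu ` {..<Suc k}) = Suc k" by (simp add: card_image)
qed simp

text \<open>
  The secular equations say that the characteristic polynomial of the arrowhead matrix vanishes at the
  \<open>k + 1\<close> points \<open>nu\<close>.
\<close>

lemma arrow_determined:
  assumes "\<And>i. i \<le> k \<Longrightarrow> nu i - a - (\<Sum>j<k. q j / (nu i - mu j)) = 0"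
  shows "arrow_fun k mu a q x = (\<Prod>i<Suc k. x - nu i)"
proof (rule arrow_fun_eqI[OF nu_set])
  fix x assume "x \<in> nu ` {..<Suc k}"
  then obtain i where i: "i \<le> k" "x = nu i" by (auto simp: less_Suc_eq_le)
  then have "arrow_fun k mu a q x = 0"
    using assms[of i] nu_neq_mu by (subst arrow_fun_factor) auto
  moreover have "(\<Prod>i<Suc k. x - nu i) = 0" using i by (intro prod_zero) (auto simp: less_Suc_eq_le)
  ultimately show "arrow_fun k mu a q x = (\<Prod>i<Suc k. x - nu i)" by simp
qed

text \<open>
  The weights make the two polynomials agree at every \<open>mu\<^sub>j\<close>, whatever \<open>a\<close> is. The value of \<open>a\<close> is
  chosen to make them agree at the one further point \<open>nu\<^sub>0\<close>.
\<close>

lemma arrow_exists: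
  obtains a where "\<And>i. i \<le> k \<Longrightarrow> nu i - a - (\<Sum>j<k. weight j / (nu i - mu j)) = 0"
proof -
  define a where "a = nu 0 - (\<Sum>j<k. weight j / (nu 0 - mu j))"
  define S where "S = insert (nu 0) (mu ` {..<k})"
  have S: "finite S" "card S = Suc k"
    using nu_neq_mu[of 0] mu_neq
    by (auto simp: S_def card_insert_if image_iff intro!: card_image[THEN trans] inj_onI)
  have eq: "arrow_fun k mu a weight x = (\<Prod>i<Suc k. x - nu i)" for x
  proof (rule arrow_fun_eqI[OF S])
    fix x assume "x \<in> S"
    then consider "x = nu 0" | j where "j < k" "x = mu j" by (auto simp: S_def)
    then show "arrow_fun k mu a weight x = (\<Prod>i<Suc k. x - nu i)"
    proof cases
      case 1
      have "arrow_fun k mu a weight x = 0"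
        unfolding 1 using nu_neq_mu[of 0] by (subst arrow_fun_factor) (auto simp: a_def)
      moreover have "(\<Prod>i<Suc k. x - nu i) = 0" unfolding 1 by (intro prod_zero) auto
      ultimately show ?thesis by simp
    next
      case 2
      then show ?thesis using weight_eq by (simp add: arrow_fun_at_mu)
    qed
  qed
  have "nu i - a - (\<Sum>j<k. weight j / (nu i - mu j)) = 0" if "i \<le> k" for i
  proof -
    have "(\<Prod>l<Suc k. nu i - nu l) = 0" using that by (intro prod_zero) (auto simp: less_Suc_eq_le)
    then have "(\<Prod>j<k. nu i - mu j) * (nu i - a - (\<Sum>j<k. weight j / (nu i - mu j))) = 0"
      using eq[of "nu i"] nu_neq_mu that by (subst (asm) arrow_fun_factor) auto
    moreover have "(\<Prod>j<k. nu i - mu j) \<noteq> 0" using nu_neq_mu that by auto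
    ultimately show ?thesis by simp
  qed
  then show ?thesis using that by blast
qed

text \<open>
  Evaluating the characteristic polynomial at \<open>mu\<^sub>j\<close> isolates the border entry \<open>q\<^sub>j\<close>.
\<close>

lemma secular_imp_weight:
  assumes "\<And>i. i \<le> k \<Longrightarrow> nu i - a - (\<Sum>j<k. q j / (nu i - mu j)) = 0" and "j < k"
  shows "q j = weight j"
proof -
  have "- q j * (\<Prod>l\<in>{..<k}-{j}. mu j - mu l) = - weight j * (\<Prod>l\<in>{..<k}-{j}. mu j - mu l)"
    using arrow_determined[OF assms(1)] arrow_fun_at_mu[OF assms(2)] weight_eq[OF assms(2)] by metis
  then show ?thesis using prod_mu_diff_nonzero[OF assms(2)] by simp
qed

text \<open>
  Evaluation at 0: the quotient of the determinants of the two Gram matrices is the Schur complement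
  \<open>a - sum q\<^sub>j / mu\<^sub>j\<close>, which is the square of the new diagonal entry.
\<close>

lemma secular_imp_schur:
  assumes "\<And>i. i \<le> k \<Longrightarrow> nu i - a - (\<Sum>j<k. q j / (nu i - mu j)) = 0"
  shows "a - (\<Sum>j<k. q j / mu j) = gain k * nu k"
proof -
  have "(\<Prod>j<k. - mu j) * (- a + (\<Sum>j<k. q j / mu j)) = (\<Prod>i<Suc k. - nu i)"
  proof -
    have "arrow_fun k mu a q 0 = (\<Prod>i<Suc k. 0 - nu i)"
      using assms by (rule arrow_determined)
    moreover have "arrow_fun k mu a q 0 = (\<Prod>j<k. 0 - mu j) * (0 - a - (\<Sum>j<k. q j / (0 - mu j)))"
      using mu_pos by (intro arrow_fun_factor) force
    ultimately show ?thesis by (simp add: sum_negf del: prod.lessThan_Suc)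
  qed
  moreover have "(\<Prod>j<k. - mu j) = (-1) ^ k * (\<Prod>j<k. mu j)"
    "(\<Prod>i<Suc k. - nu i) = (-1) ^ k * (- ((\<Prod>i<k. nu i) * nu k))"
    using prod.distrib[of "\<lambda>_. -1" mu "{..<k}"] prod.distrib[of "\<lambda>_. -1" nu "{..<k}"] by simp_all
  ultimately have "(-1) ^ k * ((\<Prod>j<k. mu j) * (a - (\<Sum>j<k. q j / mu j))) = (-1) ^ k * ((\<Prod>i<k. nu i) * nu k)"
    by (simp add: algebra_simps del: prod.lessThan_Suc)
  then have "(\<Prod>j<k. mu j) * (a - (\<Sum>j<k. q j / mu j)) = (\<Prod>i<k. nu i) * nu k"
    by simp
  moreover have "(\<Prod>j<k. mu j) > 0" using mu_pos by (intro prod_pos) auto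
  moreover have "x = n / m * y" if "m * x = n * y" "0 < m" for x y m n :: real
    using that by (simp add: eq_divide_eq mult.commute)
  ultimately show ?thesis unfolding gain_def prod_dividef by blast
qed

end

section \<open>Singular vectors of a bordered block\<close>

text \<open>
  A new row with coordinates \<open>s\<close> in the right singular vectors and diagonal entry \<open>d\<close> leads to the
  border entries \<open>sqrt mu\<^sub>j * s\<^sub>j\<close> and the corner entry \<open>d\<^sup>2 + sum s\<^sub>j\<^sup>2\<close>; the assumption says that the
  new Gram matrix has the eigenvalues \<open>nu\<close>.
\<close>

locale bordering = separated +
  fixes s :: "nat \<Rightarrow> real" and d :: real
  assumes d_pos: "0 < d"
    and secular: "\<And>i. i \<le> k \<Longrightarrow>
      nu i - (d\<^sup>2 + (\<Sum>j<k. (s j)\<^sup>2)) - (\<Sum>j<k. mu j * (s j)\<^sup>2 / (nu i - mu j)) = 0"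
begin

lemma weight_s: "j < k \<Longrightarrow> mu j * (s j)\<^sup>2 = weight j"
  using secular_imp_weight[of "d\<^sup>2 + (\<Sum>j<k. (s j)\<^sup>2)" "\<lambda>j. mu j * (s j)\<^sup>2" j] secular by simp

lemma s_sq: "j < k \<Longrightarrow> (s j)\<^sup>2 = weight j / mu j"
  using weight_s[of j] mu_pos[of j] by (simp add: field_simps)

lemma d_sq: "d\<^sup>2 = gain k * nu k"
proof -
  have "(\<Sum>j<k. mu j * (s j)\<^sup>2 / mu j) = (\<Sum>j<k. (s j)\<^sup>2)"
    using mu_pos by (intro sum.cong refl) (metis lessThan_iff less_irrefl nonzero_mult_div_cancel_left)
  then show ?thesis
    using secular_imp_schur[of "d\<^sup>2 + (\<Sum>j<k. (s j)\<^sup>2)" "\<lambda>j. mu j * (s j)\<^sup>2"] secular by simp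
qed

text \<open>
  The length of the eigenvector of the arrowhead matrix for \<open>nu\<^sub>i\<close> when its last entry is normalised to
  1. The matrix \<open>X\<close> with last row \<open>X0\<close> consists of the unit eigenvectors, and \<open>Y\<close> with last row \<open>Y0\<close>
  of the corresponding right singular vectors.
\<close>

definition len :: "nat \<Rightarrow> real" where
  "len i = sqrt (1 + (\<Sum>j<k. weight j / (nu i - mu j)\<^sup>2))"

definition X0 :: "nat \<Rightarrow> real" where "X0 i = 1 / len i"
definition X :: "nat \<Rightarrow> nat \<Rightarrow> real" where
  "X j i = sqrt (mu j) * s j / ((nu i - mu j) * len i)"
definition Y0 :: "nat \<Rightarrow> real" where "Y0 i = d / (len i * sqrt (nu i))"
definition Y :: "nat \<Rightarrow> nat \<Rightarrow> real" where
  "Y j i = s j * sqrt (nu i) / ((nu i - mu j) * len i)"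

lemma weight_quotient_nonneg: "j < k \<Longrightarrow> 0 \<le> weight j / (nu i - mu j)\<^sup>2"
  using weight_pos[of j] by simp

lemma sum_weight_nonneg: "0 \<le> (\<Sum>j<k. weight j / (nu i - mu j)\<^sup>2)"
  using weight_quotient_nonneg by (intro sum_nonneg) simp

lemma len_sq: "(len i)\<^sup>2 = 1 + (\<Sum>j<k. weight j / (nu i - mu j)\<^sup>2)"
  unfolding len_def using sum_weight_nonneg[of i] by (intro real_sqrt_pow2) simp

lemma len_ge: "1 \<le> (len i)\<^sup>2" "j < k \<Longrightarrow> weight j / (nu i - mu j)\<^sup>2 \<le> (len i)\<^sup>2"
proof -
  show "1 \<le> (len i)\<^sup>2" using sum_weight_nonneg[of i] by (simp add: len_sq)
  assume "j < k"
  then have "weight j / (nu i - mu j)\<^sup>2 \<le> (\<Sum>j<k. weight j / (nu i - mu j)\<^sup>2)"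
    using weight_quotient_nonneg by (intro member_le_sum) auto
  then show "weight j / (nu i - mu j)\<^sup>2 \<le> (len i)\<^sup>2" by (simp add: len_sq)
qed

lemma len_pos: "0 < len i"
  using sum_weight_nonneg[of i] by (simp add: len_def)

text \<open>
  Orthogonality of eigenvectors in scalar form: for \<open>i \<noteq> l\<close>, subtract the secular equations at \<open>nu\<^sub>i\<close>
  and \<open>nu\<^sub>l\<close> and divide by \<open>nu\<^sub>i - nu\<^sub>l\<close>.
\<close>

lemma resolvent_sum:
  assumes "i \<le> k" "l \<le> k"
  shows "1 + (\<Sum>j<k. weight j / ((nu i - mu j) * (nu l - mu j))) = len i * len l * of_bool (i = l)"
proof (cases "i = l")
  case True
  then show ?thesis using len_sq[of i] by (simp add: power2_eq_square)
next
  case False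
  define f where "f i = (\<Sum>j<k. weight j / (nu i - mu j))" for i
  have f: "f i = nu i - (d\<^sup>2 + (\<Sum>j<k. (s j)\<^sup>2))" if "i \<le> k" for i
    using secular[OF that] by (simp add: f_def weight_s)
  have "(nu i - nu l) * (\<Sum>j<k. weight j / ((nu i - mu j) * (nu l - mu j))) = f l - f i"
    unfolding sum_distrib_left f_def sum_subtractf[symmetric]
  proof (intro sum.cong refl)
    fix j assume "j \<in> {..<k}"
    then have "nu i - mu j \<noteq> 0" "nu l - mu j \<noteq> 0" using nu_neq_mu assms by auto
    then show "(nu i - nu l) * (weight j / ((nu i - mu j) * (nu l - mu j)))
        = weight j / (nu l - mu j) - weight j / (nu i - mu j)"
      by (simp add: divide_simps) (simp add: algebra_simps)
  qed
  also have "\<dots> = - (nu i - nu l)" using f assms by simp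
  finally have "(nu i - nu l) * (1 + (\<Sum>j<k. weight j / ((nu i - mu j) * (nu l - mu j)))) = 0"
    by (simp add: algebra_simps)
  then show ?thesis using False nu_neq[OF assms False] by simp
qed

lemma X_ortho:
  assumes "i \<le> k" "l \<le> k"
  shows "X0 i * X0 l + (\<Sum>j<k. X j i * X j l) = of_bool (i = l)"
proof -
  have "X j i * X j l = weight j / ((nu i - mu j) * (nu l - mu j)) / (len i * len l)" if "j < k" for j
  proof -
    have "X j i * X j l = (sqrt (mu j) * s j)\<^sup>2 / ((nu i - mu j) * (nu l - mu j)) / (len i * len l)"
      by (simp add: X_def power2_eq_square mult_ac)
    also have "(sqrt (mu j) * s j)\<^sup>2 = weight j"
      using that mu_pos[OF that] by (simp add: weight_s power_mult_distrib)
    finally show ?thesis .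
  qed
  then have "X0 i * X0 l + (\<Sum>j<k. X j i * X j l)
      = (1 + (\<Sum>j<k. weight j / ((nu i - mu j) * (nu l - mu j)))) / (len i * len l)"
    by (simp add: X0_def sum_divide_distrib add_divide_distrib)
  also have "\<dots> = of_bool (i = l)"
    unfolding resolvent_sum[OF assms] using len_pos[of i] len_pos[of l] by simp
  finally show ?thesis .
qed

text \<open>
  Writing \<open>nu\<^sub>l / (nu\<^sub>l - mu\<^sub>j) = 1 + mu\<^sub>j / (nu\<^sub>l - mu\<^sub>j)\<close> reduces the inner products to the
  secular equation at \<open>nu\<^sub>i\<close> and the sum evaluated in \<open>resolvent_sum\<close>.
\<close>

lemma Y_ortho:
  assumes "i \<le> k" "l \<le> k"
  shows "Y0 i * Y0 l + (\<Sum>j<k. Y j i * Y j l) = of_bool (i = l)"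
proof -
  define a where "a = d\<^sup>2 + (\<Sum>j<k. (s j)\<^sup>2)"
  define f where "f i = (\<Sum>j<k. weight j / (nu i - mu j))" for i
  define g where "g = (\<Sum>j<k. weight j / ((nu i - mu j) * (nu l - mu j)))"
  define c where "c = sqrt (nu i) * sqrt (nu l) * (len i * len l)"
  have nu: "0 < nu i" "0 < nu l" using nu_pos assms by auto
  have sq: "sqrt (nu i) * sqrt (nu i) = nu i" "sqrt (nu l) * sqrt (nu l) = nu l" using nu by auto
  have c: "0 < c" using nu len_pos by (simp add: c_def)
  have f: "f i = nu i - a" if "i \<le> k" for i
    using secular[OF that] by (simp add: f_def a_def weight_s)
  have Y0: "Y0 i * Y0 l * c = d\<^sup>2"
    using nu len_pos[of i] len_pos[of l] by (simp add: Y0_def c_def power2_eq_square)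
  have cancel: "s' * ri / (u * li) * (s' * rl / (v * ll)) * (ri * rl * (li * ll))
      = s'\<^sup>2 * ((ri * ri) * (rl * rl)) / (u * v)" if "li \<noteq> 0" "ll \<noteq> 0" for s' ri rl u v li ll :: real
    using that by (simp add: power2_eq_square)
  have Yj: "Y j i * Y j l * c
      = (s j)\<^sup>2 + weight j / (nu i - mu j) + nu i * (weight j / ((nu i - mu j) * (nu l - mu j)))" if "j < k" for j
  proof -
    have ne: "nu i - mu j \<noteq> 0" "nu l - mu j \<noteq> 0" using nu_neq_mu that assms by auto
    have "Y j i * Y j l * c = (s j)\<^sup>2 * ((sqrt (nu i) * sqrt (nu i)) * (sqrt (nu l) * sqrt (nu l)))
        / ((nu i - mu j) * (nu l - mu j))"
      unfolding Y_def c_def by (rule cancel) (use len_pos[of i] len_pos[of l] in auto)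
    also have "\<dots> = (s j)\<^sup>2 * (nu i * nu l) / ((nu i - mu j) * (nu l - mu j))"
      unfolding sq ..
    also have "\<dots> = (s j)\<^sup>2 + mu j * (s j)\<^sup>2 / (nu i - mu j) + nu i * (mu j * (s j)\<^sup>2 / ((nu i - mu j) * (nu l - mu j)))"
      using ne by (simp add: divide_simps) (simp add: algebra_simps)
    finally show ?thesis unfolding weight_s[OF that] .
  qed
  have "(Y0 i * Y0 l + (\<Sum>j<k. Y j i * Y j l)) * c = d\<^sup>2 + (\<Sum>j<k. Y j i * Y j l * c)"
    using Y0 by (simp add: distrib_right sum_distrib_right)
  also have "\<dots> = d\<^sup>2 + (\<Sum>j<k. (s j)\<^sup>2 + weight j / (nu i - mu j)
      + nu i * (weight j / ((nu i - mu j) * (nu l - mu j))))"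
    using Yj by (intro arg_cong2[where f = "(+)"] sum.cong refl) auto
  also have "\<dots> = a + f i + nu i * g"
    by (simp add: sum.distrib a_def f_def g_def sum_distrib_left)
  also have "\<dots> = nu i * (1 + g)" using f[OF assms(1)] by (simp add: algebra_simps)
  also have "\<dots> = nu i * (len i * len l * of_bool (i = l))"
    unfolding g_def resolvent_sum[OF assms] ..
  also have "\<dots> = of_bool (i = l) * c" using sq by (auto simp: c_def)
  finally show ?thesis using c by simp
qed

abbreviation err :: real where "err \<equiv> 4 ^ (k + 2) * eps"

lemma pow_bounds: "(2::real) ^ Suc k * (4 * 2 ^ Suc k) = 4 ^ (k + 2)" "(1::real) \<le> 4 * 2 ^ Suc k"
proof -
  have "(2::real) ^ Suc k * 2 ^ Suc k = 4 ^ Suc k" by (simp flip: power_mult_distrib)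
  then show 1: "(2::real) ^ Suc k * (4 * 2 ^ Suc k) = 4 ^ (k + 2)" by simp
  have "(1::real) \<le> 2 ^ Suc k" by (rule one_le_power) simp
  then show 2: "(1::real) \<le> 4 * 2 ^ Suc k" by linarith
qed

text \<open>
  The entry with index \<open>i - 1\<close> dominates the \<open>i\<close>-th eigenvector; for \<open>i = 0\<close> it is the entry in the
  new coordinate.
\<close>

lemma len_lower: assumes "i \<le> k" shows "gain i \<le> 2 ^ Suc k * (len i)\<^sup>2"
proof (cases i)
  case 0
  have "1 * 1 \<le> 2 ^ Suc k * (len i)\<^sup>2"
    using len_ge(1)[of i] one_le_power[of "2::real" "Suc k"] by (intro mult_mono) (auto simp del: power_Suc)
  then show ?thesis using 0 by (simp add: gain_0)
next
  case (Suc j)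
  then have j: "j < k" using assms by simp
  have pos: "0 < mu j" "0 < nu i" "nu i \<le> mu j / 2"
    using mu_pos[OF j] nu_pos[OF assms] nu_le_half_mu[of j i] Suc assms by auto
  have "(nu i - mu j)\<^sup>2 \<le> (mu j)\<^sup>2" using pos by (intro power2_le_iff_abs_le[THEN iffD2]) auto
  moreover have "0 < (nu i - mu j)\<^sup>2" using pos by simp
  ultimately have "((mu j)\<^sup>2 * gain i / 2 ^ Suc k) / (mu j)\<^sup>2 \<le> weight j / (nu i - mu j)\<^sup>2"
    using weight_bounds(1)[OF j] weight_pos[OF j] Suc by (intro frac_le) auto
  also have "\<dots> \<le> (len i)\<^sup>2" by (rule len_ge(2)[OF j])
  finally show ?thesis using pos by (simp add: field_simps)
qed

text \<open>
  The common last step of the four estimates below: a squared entry of an unnormalised vector that is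
  smaller than \<open>gain i\<close> by the factor \<open>eps\<close> is small after normalisation.
\<close>

lemma quotient_by_len:
  assumes "i \<le> k" "0 \<le> z" "z \<le> eps * gain i" "x \<le> 4 * 2 ^ Suc k * z"
  shows "x / (len i)\<^sup>2 \<le> err"
proof -
  have g: "0 < gain i" using gain_pos assms(1) by simp
  have "x \<le> 4 * 2 ^ Suc k * (eps * gain i)"
    using assms(3,4) by (smt (verit) mult_left_mono zero_less_power)
  also have "\<dots> \<le> 4 * 2 ^ Suc k * (eps * (2 ^ Suc k * (len i)\<^sup>2))"
    using len_lower[OF assms(1)] eps by (intro mult_left_mono) auto
  also have "\<dots> = (2 ^ Suc k * (4 * 2 ^ Suc k)) * eps * (len i)\<^sup>2" by (simp add: mult_ac)
  also have "\<dots> = err * (len i)\<^sup>2" unfolding pow_bounds by simp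
  finally show ?thesis using len_pos[of i] by (simp add: divide_le_eq)
qed

lemma X_sq: "j < k \<Longrightarrow> (X j i)\<^sup>2 = weight j / (nu i - mu j)\<^sup>2 / (len i)\<^sup>2"
  using weight_s[of j] mu_pos[of j] by (simp add: X_def power_divide power_mult_distrib)

lemma Y_sq: "j < k \<Longrightarrow> i \<le> k \<Longrightarrow> (Y j i)\<^sup>2 = (weight j / mu j * nu i) / (nu i - mu j)\<^sup>2 / (len i)\<^sup>2"
  using s_sq[of j] nu_pos[of i] by (simp add: Y_def power_divide power_mult_distrib)

text \<open>
  The factor \<open>2\<^bsup>k+1\<^esup>\<close> comes from \<open>weight_bounds\<close>, and 4 from replacing the difference of two separated
  numbers by half of the larger one.
\<close>

lemma weight_quotient:
  assumes "j < k" "i \<le> k"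
  shows "j < i \<Longrightarrow> weight j / (nu i - mu j)\<^sup>2 \<le> 4 * 2 ^ Suc k * gain (Suc j)"
    and "i \<le> j \<Longrightarrow> weight j / (nu i - mu j)\<^sup>2 \<le> 4 * 2 ^ Suc k * (gain (Suc j) * (mu j)\<^sup>2 / (nu i)\<^sup>2)"
proof -
  have pos: "0 < mu j" "0 < nu i" "0 < gain (Suc j)"
    using mu_pos nu_pos gain_pos[of "Suc j"] assms by auto
  have *: "weight j / (nu i - mu j)\<^sup>2 \<le> 4 * 2 ^ Suc k * (gain (Suc j) * (mu j)\<^sup>2 / m\<^sup>2)"
    if "0 < m" "m / 2 \<le> \<bar>nu i - mu j\<bar>" for m
  proof -
    have "(m / 2)\<^sup>2 \<le> \<bar>nu i - mu j\<bar>\<^sup>2" using that by (intro power_mono) auto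
    then have "weight j / (nu i - mu j)\<^sup>2 \<le> (2 ^ Suc k * ((mu j)\<^sup>2 * gain (Suc j))) / (m / 2)\<^sup>2"
      using weight_bounds(2)[OF assms(1)] weight_pos[OF assms(1)] that pos by (intro frac_le) auto
    also have "\<dots> = 4 * 2 ^ Suc k * (gain (Suc j) * (mu j)\<^sup>2 / m\<^sup>2)"
      by (simp add: power_divide)
    finally show ?thesis .
  qed
  show "weight j / (nu i - mu j)\<^sup>2 \<le> 4 * 2 ^ Suc k * gain (Suc j)" if "j < i"
    using *[of "mu j"] nu_le_half_mu[OF that assms(2)] pos by simp
  show "weight j / (nu i - mu j)\<^sup>2 \<le> 4 * 2 ^ Suc k * (gain (Suc j) * (mu j)\<^sup>2 / (nu i)\<^sup>2)" if "i \<le> j"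
    using *[of "nu i"] mu_le_half_nu[OF that assms(1)] pos by simp
qed

lemma X0_small: assumes "0 < i" "i \<le> k" shows "(X0 i)\<^sup>2 \<le> err"
proof -
  have "1 \<le> eps * gain i" using gain_le[of 0 i] assms by (simp add: gain_0)
  moreover have "(1::real) \<le> 4 * 2 ^ Suc k * 1"
    using pow_bounds(2) by simp
  ultimately have "1 / (len i)\<^sup>2 \<le> err" by (intro quotient_by_len[where z = 1]) (use assms in auto)
  then show ?thesis by (simp add: X0_def power_divide)
qed

text \<open>
  With \<open>Y_small\<close> and the bounds for \<open>X0\<close> and \<open>Y0\<close>: \<open>X\<close> is close to the shift that moves index \<open>j\<close>
  to \<open>j + 1\<close> and the new index to 0, while \<open>Y\<close> is close to a diagonal matrix.
\<close>

lemma X_small: assumes "j < k" "i \<le> k" "Suc j \<noteq> i" shows "(X j i)\<^sup>2 \<le> err"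
proof (cases "j < i")
  case True
  then have "gain (Suc j) \<le> eps * gain i" using assms by (intro gain_le) auto
  then show ?thesis unfolding X_sq[OF assms(1)]
    using weight_quotient(1)[OF assms(1,2) True] gain_pos[of "Suc j"] assms
    by (intro quotient_by_len[where z = "gain (Suc j)"]) auto
next
  case False
  then have ij: "i \<le> j" by simp
  have pos: "0 < mu j" "0 < nu i" "0 < gain (Suc j)" "0 < gain i"
    using mu_pos nu_pos gain_pos[of "Suc j"] gain_pos[of i] assms by auto
  have "gain (Suc j) * (mu j)\<^sup>2 = (gain j * nu j) * mu j"
    using gain_Suc_mu[OF assms(1)] by (simp add: power2_eq_square mult_ac)
  also have "\<dots> \<le> (gain i * nu i) * (eps * nu i)"
    by (rule mult_mono) (use gain_nu_antimono[OF ij] mu_le_nu[OF ij] assms pos in auto)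
  finally have "gain (Suc j) * (mu j)\<^sup>2 / (nu i)\<^sup>2 \<le> eps * gain i"
    using pos by (simp add: divide_le_eq power2_eq_square mult_ac)
  then show ?thesis unfolding X_sq[OF assms(1)]
    using weight_quotient(2)[OF assms(1,2) ij] pos assms
    by (intro quotient_by_len[where z = "gain (Suc j) * (mu j)\<^sup>2 / (nu i)\<^sup>2"]) auto
qed

lemma Y0_small: assumes "i < k" shows "(Y0 i)\<^sup>2 \<le> err"
proof -
  have pos: "0 < nu i" "0 < gain k" "0 < nu k"
    using nu_pos gain_pos[of k] assms by auto
  have "gain k * nu k \<le> eps * (gain i * nu i)" using assms by (intro gain_nu_le) auto
  then have 1: "gain k * nu k / nu i \<le> eps * gain i" using pos by (simp add: divide_le_eq)
  have "1 * (gain k * nu k / nu i) \<le> 4 * 2 ^ Suc k * (gain k * nu k / nu i)"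
    using pow_bounds(2) pos by (intro mult_right_mono) auto
  then have "(gain k * nu k / nu i) / (len i)\<^sup>2 \<le> err"
    using 1 pos assms by (intro quotient_by_len[where z = "gain k * nu k / nu i"]) auto
  moreover have "(Y0 i)\<^sup>2 = (gain k * nu k / nu i) / (len i)\<^sup>2"
    using pos by (simp add: Y0_def power_divide power_mult_distrib d_sq)
  ultimately show ?thesis by simp
qed

lemma Y_small: assumes "j < k" "i \<le> k" "j \<noteq> i" shows "(Y j i)\<^sup>2 \<le> err"
proof -
  have pos: "0 < mu j" "0 < nu i" "0 < gain (Suc j)" "0 < gain i"
    using mu_pos nu_pos gain_pos[of "Suc j"] gain_pos[of i] assms by auto
  have Y: "(Y j i)\<^sup>2 = (weight j / (nu i - mu j)\<^sup>2 * (nu i / mu j)) / (len i)\<^sup>2"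
    using assms by (simp add: Y_sq)
  show ?thesis
  proof (cases "j < i")
    case True
    have "gain (Suc j) * (nu i / mu j) \<le> gain i * eps"
      using gain_mono[of "Suc j" i] nu_le_mu[OF True assms(2)] True assms pos
      by (intro mult_mono) (auto simp: divide_le_eq)
    moreover have "weight j / (nu i - mu j)\<^sup>2 * (nu i / mu j) \<le> 4 * 2 ^ Suc k * gain (Suc j) * (nu i / mu j)"
      using weight_quotient(1)[OF assms(1,2) True] pos by (intro mult_right_mono) auto
    ultimately show ?thesis unfolding Y using pos assms
      by (intro quotient_by_len[where z = "gain (Suc j) * (nu i / mu j)"]) (auto simp: mult_ac)
  next
    case False
    then have ij: "i < j" "i \<le> j" using assms by auto
    define z where "z = gain (Suc j) * (mu j)\<^sup>2 / (nu i)\<^sup>2 * (nu i / mu j)"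
    have "z = gain j * nu j / nu i"
      using gain_Suc_mu[OF assms(1)] pos by (simp add: z_def power2_eq_square)
    also have "\<dots> \<le> eps * gain i"
      using gain_nu_le[OF ij(1)] assms pos by (simp add: divide_le_eq)
    finally have z: "z \<le> eps * gain i" .
    have "weight j / (nu i - mu j)\<^sup>2 * (nu i / mu j) \<le> 4 * 2 ^ Suc k * (gain (Suc j) * (mu j)\<^sup>2 / (nu i)\<^sup>2) * (nu i / mu j)"
      using weight_quotient(2)[OF assms(1,2) ij(2)] pos by (intro mult_right_mono) auto
    then have "weight j / (nu i - mu j)\<^sup>2 * (nu i / mu j) \<le> 4 * 2 ^ Suc k * z"
      by (simp only: z_def mult.assoc)
    moreover have "0 \<le> z" using pos by (simp add: z_def)
    ultimately show ?thesis unfolding Y using z assms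
      by (intro quotient_by_len[where z = z]) auto
  qed
qed

end

section \<open>Singular value decompositions of nested blocks\<close>

definition svd :: "nat \<Rightarrow> (nat \<Rightarrow> nat \<Rightarrow> real) \<Rightarrow> (nat \<Rightarrow> nat \<Rightarrow> real) \<Rightarrow> (nat \<Rightarrow> nat \<Rightarrow> real)
    \<Rightarrow> (nat \<Rightarrow> real) \<Rightarrow> bool" where
  "svd k B U V mu \<longleftrightarrow> ortho k U \<and> ortho k V \<and>
     (\<forall>p<k. \<forall>q<k. B p q = (\<Sum>j<k. U p j * sqrt (mu j) * V q j))"

text \<open>
  Closeness of \<open>U\<close> to a signed antidiagonal and of \<open>V\<close> to a signed diagonal matrix. Only the small
  entries are controlled; for orthogonal matrices the dominant ones then have absolute value close
  to 1.
\<close>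

definition near_signed_perm :: "nat \<Rightarrow> real \<Rightarrow> (nat \<Rightarrow> nat \<Rightarrow> real) \<Rightarrow> (nat \<Rightarrow> nat \<Rightarrow> real) \<Rightarrow> bool" where
  "near_signed_perm k e U V \<longleftrightarrow>
     (\<forall>p<k. \<forall>j<k. p \<noteq> j \<longrightarrow> \<bar>U (k - 1 - p) j\<bar> \<le> e \<and> \<bar>V p j\<bar> \<le> e)"

definition gram :: "nat \<Rightarrow> (nat \<Rightarrow> nat \<Rightarrow> real) \<Rightarrow> nat \<Rightarrow> nat \<Rightarrow> real" where
  "gram k B p q = (\<Sum>l<k. B p l * B q l)"

text \<open>
  Eigenvalues are given through eigenvectors. For pairwise distinct \<open>mu\<close> this determines the whole
  spectrum.
\<close>

definition gram_spectrum :: "nat \<Rightarrow> (nat \<Rightarrow> nat \<Rightarrow> real) \<Rightarrow> (nat \<Rightarrow> real) \<Rightarrow> bool" where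
  "gram_spectrum k B mu \<longleftrightarrow> (\<forall>i<k. \<exists>y. (\<exists>p<k. y p \<noteq> 0) \<and>
     (\<forall>p<k. (\<Sum>q<k. gram k B p q * y q) = mu i * y p))"

lemma svd_gram:
  assumes "svd k B U V mu" "\<And>j. j < k \<Longrightarrow> 0 \<le> mu j" "p < k" "q < k"
  shows "gram k B p q = (\<Sum>j<k. U p j * (mu j * U q j))"
proof -
  have "gram k B p q = (\<Sum>l<k. (\<Sum>j<k. V l j * (U p j * sqrt (mu j))) * (\<Sum>j<k. V l j * (U q j * sqrt (mu j))))"
    using assms(1,3,4) by (simp add: gram_def svd_def mult_ac)
  also have "\<dots> = (\<Sum>j<k. (U p j * sqrt (mu j)) * (U q j * sqrt (mu j)))"
    using assms(1) by (intro ortho_inner) (simp add: svd_def)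
  also have "\<dots> = (\<Sum>j<k. U p j * (mu j * U q j))"
  proof (intro sum.cong refl)
    fix j assume "j \<in> {..<k}"
    then have "sqrt (mu j) * sqrt (mu j) = mu j" using assms(2) by simp
    moreover have "(U p j * sqrt (mu j)) * (U q j * sqrt (mu j)) = U p j * ((sqrt (mu j) * sqrt (mu j)) * U q j)"
      by (simp only: mult_ac)
    ultimately show "(U p j * sqrt (mu j)) * (U q j * sqrt (mu j)) = U p j * (mu j * U q j)"
      by simp
  qed
  finally show ?thesis .
qed

lemma svd_gram_apply:
  assumes "svd k B U V mu" "\<And>j. j < k \<Longrightarrow> 0 \<le> mu j" "p < k"
  shows "(\<Sum>q<k. gram k B p q * y q) = (\<Sum>j<k. U p j * (mu j * (\<Sum>q<k. U q j * y q)))"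
proof -
  have "(\<Sum>q<k. gram k B p q * y q) = (\<Sum>q<k. \<Sum>j<k. U p j * (mu j * (U q j * y q)))"
    using assms by (intro sum.cong refl) (simp add: svd_gram sum_distrib_left sum_distrib_right mult_ac)
  also have "\<dots> = (\<Sum>j<k. \<Sum>q<k. U p j * (mu j * (U q j * y q)))" by (rule sum.swap)
  finally show ?thesis by (simp add: sum_distrib_left)
qed

lemma svd_imp_gram_spectrum:
  assumes "svd k B U V mu" "\<And>j. j < k \<Longrightarrow> 0 \<le> mu j"
  shows "gram_spectrum k B mu"
  unfolding gram_spectrum_def
proof (intro allI impI)
  fix i assume i: "i < k"
  have U: "ortho k U" using assms(1) by (simp add: svd_def)
  have "(\<Sum>p<k. U p i * U p i) \<noteq> 0" using U i by (simp add: ortho_def)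
  then have nz: "\<exists>p<k. U p i \<noteq> 0" by (metis (no_types, lifting) lessThan_iff mult_zero_left sum.neutral)
  have "(\<Sum>q<k. gram k B p q * U q i) = mu i * U p i" if p: "p < k" for p
  proof -
    have "(\<Sum>q<k. gram k B p q * U q i) = (\<Sum>j<k. U p j * (mu j * of_bool (j = i)))"
      using U i by (simp add: svd_gram_apply[OF assms p] ortho_def)
    also have "\<dots> = mu i * U p i" using i by (simp add: of_bool_def if_distrib cong: if_cong)
    finally show ?thesis .
  qed
  then show "\<exists>y. (\<exists>p<k. y p \<noteq> 0) \<and> (\<forall>p<k. (\<Sum>q<k. gram k B p q * y q) = mu i * y p)"
    using nz by (intro exI[of _ "\<lambda>p. U p i"]) auto
qed

context bordering
begin

text \<open>
  The columns of \<open>X\<close> and \<open>Y\<close> were chosen such that the transpose of the new block maps each new left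
  singular vector to \<open>sqrt nu\<^sub>i\<close> times the right one. As the left ones form an orthonormal basis, this
  determines the block.
\<close>

lemma svd_step:
  assumes svd: "svd k B U V mu"
    and row: "\<And>q. q < k \<Longrightarrow> B k q = (\<Sum>j<k. s j * V q j)" and "B k k = d"
    and col: "\<And>p. p < k \<Longrightarrow> B p k = 0"
  shows "svd (Suc k) B (bordered k U X0 X) (bordered k V Y0 Y) nu"
proof -
  have U: "ortho k U" and V: "ortho k V" using svd by (auto simp: svd_def)
  define U' where "U' = bordered k U X0 X"
  define V' where "V' = bordered k V Y0 Y"
  have U': "ortho (Suc k) U'"
    unfolding U'_def using U X_ortho by (intro ortho_bordered) auto
  have V': "ortho (Suc k) V'"
    unfolding V'_def using V Y_ortho by (intro ortho_bordered) auto
  have BU: "(\<Sum>p<Suc k. B p q * U' p i) = sqrt (nu i) * V' q i" if q: "q < Suc k" and i: "i < Suc k" for q i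
  proof (cases "q = k")
    case True
    then show ?thesis using nu_pos[of i] i len_pos[of i] col
      by (simp add: U'_def V'_def bordered_def X0_def Y0_def \<open>B k k = d\<close>)
  next
    case False
    then have q: "q < k" using q by simp
    have "(\<Sum>p<k. B p q * U' p i)
        = (\<Sum>p<k. (\<Sum>j<k. U p j * (sqrt (mu j) * V q j)) * (\<Sum>j<k. U p j * X j i))"
      using svd q by (intro sum.cong refl) (simp add: svd_def U'_def bordered_def mult.assoc)
    also have "\<dots> = (\<Sum>j<k. sqrt (mu j) * V q j * X j i)" by (rule ortho_inner[OF U])
    finally have "(\<Sum>p<Suc k. B p q * U' p i) = (\<Sum>j<k. sqrt (mu j) * V q j * X j i) + (\<Sum>j<k. s j * V q j) * X0 i"
      using q by (simp add: row U'_def bordered_def)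
    also have "\<dots> = (\<Sum>j<k. V q j * (sqrt (mu j) * X j i + s j * X0 i))"
      by (simp add: sum_distrib_left sum_distrib_right distrib_left sum.distrib mult_ac)
    also have "\<dots> = (\<Sum>j<k. V q j * (sqrt (nu i) * Y j i))"
    proof (intro sum.cong refl arg_cong2[where f = "(*)"])
      fix j assume "j \<in> {..<k}"
      then have j: "j < k" by simp
      have ne: "nu i - mu j \<noteq> 0" using nu_neq_mu[of i j] i j by simp
      have "sqrt (mu j) * X j i = mu j * s j / ((nu i - mu j) * len i)"
        using mu_pos[OF j] by (simp add: X_def)
      moreover have "sqrt (nu i) * Y j i = nu i * s j / ((nu i - mu j) * len i)"
        using nu_pos[of i] i by (simp add: Y_def)
      moreover have "s j * X0 i = (nu i - mu j) * s j / ((nu i - mu j) * len i)"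
        using ne by (simp add: X0_def)
      ultimately show "sqrt (mu j) * X j i + s j * X0 i = sqrt (nu i) * Y j i"
        by (simp add: left_diff_distrib diff_divide_distrib)
    qed
    also have "\<dots> = sqrt (nu i) * V' q i"
      using q by (simp add: V'_def bordered_def sum_distrib_left mult_ac)
    finally show ?thesis .
  qed
  have "B p q = (\<Sum>i<Suc k. U' p i * sqrt (nu i) * V' q i)" if pq: "p < Suc k" "q < Suc k" for p q
  proof -
    have "B p q = (\<Sum>i<Suc k. (\<Sum>r<Suc k. B r q * U' r i) * U' p i)"
      by (rule ortho_row_expansion[OF U' pq(1), of "\<lambda>r. B r q", symmetric])
    also have "\<dots> = (\<Sum>i<Suc k. U' p i * sqrt (nu i) * V' q i)"
      using BU pq by (intro sum.cong refl) (simp add: mult_ac del: sum.lessThan_Suc)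
    finally show ?thesis .
  qed
  then show ?thesis using U' V' unfolding U'_def V'_def svd_def by blast
qed

lemma X_abs_le_1: assumes "j < k" "i \<le> k" shows "\<bar>X j i\<bar> \<le> 1"
proof -
  have "X j i * X j i \<le> (\<Sum>j<k. X j i * X j i)" using assms by (intro member_le_sum) auto
  also have "\<dots> \<le> 1" using X_ortho[of i i] zero_le_square[of "X0 i"] assms by (smt (verit) of_bool_eq(2))
  finally have "(X j i)\<^sup>2 \<le> 1" by (simp add: power2_eq_square)
  then show ?thesis by (simp add: abs_square_le_1)
qed

lemma Y_abs_le_1: assumes "j < k" "i \<le> k" shows "\<bar>Y j i\<bar> \<le> 1"
proof -
  have "Y j i * Y j i \<le> (\<Sum>j<k. Y j i * Y j i)" using assms by (intro member_le_sum) auto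
  also have "\<dots> \<le> 1" using Y_ortho[of i i] zero_le_square[of "Y0 i"] assms by (smt (verit) of_bool_eq(2))
  finally have "(Y j i)\<^sup>2 \<le> 1" by (simp add: power2_eq_square)
  then show ?thesis by (simp add: abs_square_le_1)
qed

lemma X_dominant:
  assumes "m < k" "err \<le> x\<^sup>2" "0 \<le> x" "real (Suc k) * x \<le> 1 / 4"
  shows "1 / 2 \<le> \<bar>X m (Suc m)\<bar>"
proof -
  define f where "f q = (if q = k then X0 (Suc m) else X q (Suc m))" for q
  have "1 / 2 \<le> \<bar>f m\<bar>"
  proof (rule unit_vector_dominant[of "{..<Suc k}" m f x])
    have "(\<Sum>q<k. f q * f q) = (\<Sum>q<k. X q (Suc m) * X q (Suc m))"
      by (intro sum.cong refl) (simp add: f_def)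
    then show "(\<Sum>q<Suc k. f q * f q) = 1"
      using X_ortho[of "Suc m" "Suc m"] assms(1) by (simp add: f_def)
    fix q assume "q \<in> {..<Suc k}" "q \<noteq> m"
    then have "(f q)\<^sup>2 \<le> x\<^sup>2"
      using X0_small[of "Suc m"] X_small[of q "Suc m"] assms(1,2) by (auto simp: f_def)
    then show "\<bar>f q\<bar> \<le> x" using assms(3) by (metis power2_le_iff_abs_le)
  qed (use assms in auto)
  then show ?thesis using assms(1) by (simp add: f_def)
qed

lemma Y_dominant:
  assumes "m < k" "err \<le> x\<^sup>2" "0 \<le> x" "real (Suc k) * x \<le> 1 / 4"
  shows "1 / 2 \<le> \<bar>Y m m\<bar>"
proof -
  define f where "f q = (if q = k then Y0 m else Y q m)" for q
  have "1 / 2 \<le> \<bar>f m\<bar>"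
  proof (rule unit_vector_dominant[of "{..<Suc k}" m f x])
    have "(\<Sum>q<k. f q * f q) = (\<Sum>q<k. Y q m * Y q m)"
      by (intro sum.cong refl) (simp add: f_def)
    then show "(\<Sum>q<Suc k. f q * f q) = 1"
      using Y_ortho[of m m] assms(1) by (simp add: f_def)
    fix q assume "q \<in> {..<Suc k}" "q \<noteq> m"
    then have "(f q)\<^sup>2 \<le> x\<^sup>2"
      using Y0_small[of m] Y_small[of q m] assms(1,2) by (auto simp: f_def)
    then show "\<bar>f q\<bar> \<le> x" using assms(3) by (metis power2_le_iff_abs_le)
  qed (use assms in auto)
  then show ?thesis using assms(1) by (simp add: f_def)
qed

text \<open>
  The dominant entry of \<open>X\<close> has the denominator \<open>nu\<^bsub>m+1\<^esub> - mu\<^sub>m < 0\<close>, which flips the sign; for \<open>Y\<close>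
  the denominator \<open>nu\<^sub>m - mu\<^sub>m\<close> is positive.
\<close>

lemma sgn_X: assumes "m < k" shows "sgn (X m (Suc m)) = - sgn (s m)"
proof -
  have "nu (Suc m) - mu m < 0" using nu_le_half_mu[of m "Suc m"] mu_pos[of m] assms by auto
  then show ?thesis using mu_pos[OF assms] len_pos[of "Suc m"]
    by (simp add: X_def sgn_mult sgn_divide)
qed

lemma sgn_Y: assumes "m < k" shows "sgn (Y m m) = sgn (s m)"
proof -
  have "0 < nu m - mu m" using mu_le_half_nu[of m m] nu_pos[of m] assms by auto
  then show ?thesis using nu_pos[of m] assms len_pos[of m]
    by (simp add: Y_def sgn_mult sgn_divide)
qed

end

lemma sum_product_small:
  fixes f g :: "nat \<Rightarrow> real"
  assumes "\<And>j. j \<in> A \<Longrightarrow> \<bar>f j\<bar> \<le> e \<and> \<bar>g j\<bar> \<le> 1 \<or> \<bar>f j\<bar> \<le> 1 \<and> \<bar>g j\<bar> \<le> e" "0 \<le> e"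
  shows "\<bar>\<Sum>j\<in>A. f j * g j\<bar> \<le> real (card A) * e"
proof -
  have "\<bar>\<Sum>j\<in>A. f j * g j\<bar> \<le> (\<Sum>j\<in>A. \<bar>f j * g j\<bar>)" by (rule sum_abs)
  also have "\<dots> \<le> (\<Sum>j\<in>A. e)"
  proof (rule sum_mono)
    fix j assume "j \<in> A"
    then consider "\<bar>f j\<bar> \<le> e" "\<bar>g j\<bar> \<le> 1" | "\<bar>f j\<bar> \<le> 1" "\<bar>g j\<bar> \<le> e" using assms(1) by blast
    then show "\<bar>f j * g j\<bar> \<le> e"
    proof cases
      case 1
      then have "\<bar>f j\<bar> * \<bar>g j\<bar> \<le> e * 1" using assms(2) by (intro mult_mono) auto
      then show ?thesis by (simp add: abs_mult)
    next
      case 2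
      then have "\<bar>f j\<bar> * \<bar>g j\<bar> \<le> 1 * e" using assms(2) by (intro mult_mono) auto
      then show ?thesis by (simp add: abs_mult)
    qed
  qed
  finally show ?thesis by simp
qed

lemma sgn_sum_dominant:
  fixes f g :: "nat \<Rightarrow> real"
  assumes "m < k" "1 / 2 \<le> \<bar>f m\<bar>" "1 / 2 \<le> \<bar>g m\<bar>" "0 \<le> e" "real k * e \<le> 1 / 8"
    and "\<And>j. j < k \<Longrightarrow> j \<noteq> m \<Longrightarrow> \<bar>f j\<bar> \<le> e \<and> \<bar>g j\<bar> \<le> 1"
  shows "sgn (\<Sum>j<k. f j * g j) = sgn (f m) * sgn (g m)"
proof -
  have "1 / 2 * (1 / 2) \<le> \<bar>f m\<bar> * \<bar>g m\<bar>" using assms by (intro mult_mono) auto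
  then have 1: "1 / 4 \<le> \<bar>f m * g m\<bar>" by (simp add: abs_mult)
  have "\<bar>\<Sum>j\<in>{..<k}-{m}. f j * g j\<bar> \<le> real (card ({..<k}-{m})) * e"
    using assms by (intro sum_product_small) auto
  also have "\<dots> \<le> real k * e" using assms by (intro mult_right_mono) auto
  finally have 2: "\<bar>\<Sum>j\<in>{..<k}-{m}. f j * g j\<bar> \<le> 1 / 8" using assms by simp
  have "(\<Sum>j<k. f j * g j) = f m * g m + (\<Sum>j\<in>{..<k}-{m}. f j * g j)"
    using assms(1) by (intro sum.remove) auto
  moreover have "sgn (a + r) = sgn a" if "1 / 4 \<le> \<bar>a\<bar>" "\<bar>r\<bar> \<le> 1 / 8" for a r :: real
  proof (cases "0 < a")
    case True
    then have "0 < a + r" using that by linarith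
    then show ?thesis using True by simp
  next
    case False
    then have "a < 0" "a + r < 0" using that by linarith+
    then show ?thesis by simp
  qed
  ultimately have "sgn (\<Sum>j<k. f j * g j) = sgn (f m * g m)" using 1 2 by simp
  then show ?thesis by (simp add: sgn_mult)
qed

definition diag_dominant :: "nat \<Rightarrow> nat \<Rightarrow> real \<Rightarrow> (nat \<Rightarrow> nat \<Rightarrow> real) \<Rightarrow> bool" where
  "diag_dominant i k e A \<longleftrightarrow>
     (\<forall>p<i. 1 / 2 \<le> \<bar>A p p\<bar> \<and> (\<forall>j<k. j \<noteq> p \<longrightarrow> \<bar>A p j\<bar> \<le> e))"

lemma near_imp_diag_dominant:
  assumes near: "near_signed_perm k e U V" and U: "ortho k U" and V: "ortho k V"
    and e: "0 \<le> e" "real k * e \<le> 1 / 8"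
  shows "diag_dominant k k e (\<lambda>p. U (k - 1 - p))" "diag_dominant k k e V"
proof -
  have "1 / 2 \<le> \<bar>U (k - 1 - p) p\<bar>" if p: "p < k" for p
  proof (rule ortho_diag_ge_half[OF U])
    fix q assume q: "q < k" "q \<noteq> k - 1 - p"
    then have "k - 1 - q < k" "k - 1 - q \<noteq> p" "k - 1 - (k - 1 - q) = q" using p by auto
    then show "\<bar>U q p\<bar> \<le> e" using near p unfolding near_signed_perm_def by metis
  qed (use p e in auto)
  then show "diag_dominant k k e (\<lambda>p. U (k - 1 - p))"
    using near by (auto simp: diag_dominant_def near_signed_perm_def)
  have "1 / 2 \<le> \<bar>V p p\<bar>" if p: "p < k" for p
    by (rule ortho_diag_ge_half[OF V p p e(1)]) (use near p e in \<open>auto simp: near_signed_perm_def\<close>)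
  then show "diag_dominant k k e V"
    using near by (auto simp: diag_dominant_def near_signed_perm_def)
qed

context bordering
begin

text \<open>
  An entry of the new singular vectors is a sum of \<open>k\<close> products in which one factor is small and the
  other at most 1, since the dominant positions of \<open>U\<close> and \<open>X\<close> (of \<open>V\<close> and \<open>Y\<close>) compose to the
  dominant positions of the product. The error grows by a factor at most \<open>k + 1\<close>.
\<close>

lemma near_step:
  assumes near: "near_signed_perm k e U V" and U: "ortho k U" and V: "ortho k V"
    and x: "err \<le> x\<^sup>2" "0 \<le> x" "x \<le> e"
  shows "near_signed_perm (Suc k) (real (Suc k) * e) (bordered k U X0 X) (bordered k V Y0 Y)"
  unfolding near_signed_perm_def
proof (intro allI impI conjI)
  fix p i assume pi: "p < Suc k" "i < Suc k" "p \<noteq> i"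
  have e: "0 \<le> e" using x by simp
  have le: "real k * e \<le> real (Suc k) * e" "e \<le> real (Suc k) * e"
    using e by (auto simp: algebra_simps)
  have sq: "\<bar>z\<bar> \<le> e" if "z\<^sup>2 \<le> err" for z
    using that x power2_le_iff_abs_le[of x z] by simp
  show "\<bar>bordered k U X0 X (Suc k - 1 - p) i\<bar> \<le> real (Suc k) * e"
  proof (cases p)
    case 0
    then show ?thesis using pi sq[OF X0_small[of i]] le by (simp add: bordered_def)
  next
    case (Suc m)
    then have m: "m < k" using pi by simp
    have "\<bar>\<Sum>j<k. U (k - 1 - m) j * X j i\<bar> \<le> real (card {..<k}) * e"
    proof (rule sum_product_small[OF _ e])
      fix j assume "j \<in> {..<k}"
      then have j: "j < k" by simp
      show "\<bar>U (k - 1 - m) j\<bar> \<le> e \<and> \<bar>X j i\<bar> \<le> 1 \<or> \<bar>U (k - 1 - m) j\<bar> \<le> 1 \<and> \<bar>X j i\<bar> \<le> e"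
      proof (cases "j = m")
        case True
        then show ?thesis using sq[OF X_small[OF j]] ortho_abs_le_1[OF U, of "k - 1 - m" j] j Suc pi by auto
      next
        case False
        then show ?thesis using near X_abs_le_1[OF j] j m pi by (auto simp: near_signed_perm_def)
      qed
    qed
    moreover have "k - Suc m \<noteq> k" using m by simp
    ultimately show ?thesis using Suc le by (simp add: bordered_def)
  qed
  show "\<bar>bordered k V Y0 Y p i\<bar> \<le> real (Suc k) * e"
  proof (cases "p = k")
    case True
    then show ?thesis using pi sq[OF Y0_small[of i]] le by (simp add: bordered_def)
  next
    case False
    then have p: "p < k" using pi by simp
    have "\<bar>\<Sum>j<k. V p j * Y j i\<bar> \<le> real (card {..<k}) * e"
    proof (rule sum_product_small[OF _ e])
      fix j assume "j \<in> {..<k}"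
      then have j: "j < k" by simp
      show "\<bar>V p j\<bar> \<le> e \<and> \<bar>Y j i\<bar> \<le> 1 \<or> \<bar>V p j\<bar> \<le> 1 \<and> \<bar>Y j i\<bar> \<le> e"
      proof (cases "j = p")
        case True
        then show ?thesis using sq[OF Y_small[OF j]] ortho_abs_le_1[OF V, of p j] j pi by auto
      next
        case False
        then show ?thesis using near Y_abs_le_1[OF j] j p pi by (auto simp: near_signed_perm_def)
      qed
    qed
    then show ?thesis using p le by (simp add: bordered_def)
  qed
qed

text \<open>
  How the dominant entries change sign from one block to the next. Together with \<open>sgn_corner\<close> this
  is all the sign information that enters the minors.
\<close>

lemma sgn_diagonal_step:
  assumes near: "near_signed_perm k e U V" and U: "ortho k U" and V: "ortho k V"
    and x: "err \<le> x\<^sup>2" "0 \<le> x" "x \<le> e" "real (Suc k) * e \<le> 1 / 8" and m: "m < k"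
  shows "sgn (bordered k U X0 X (k - Suc m) (Suc m)) = - sgn (s m) * sgn (U (k - Suc m) m)"
    and "sgn (bordered k V Y0 Y m m) = sgn (s m) * sgn (V m m)"
proof -
  have e: "0 \<le> e" using x by simp
  have ke: "real k * e \<le> 1 / 8" using x e by (simp add: algebra_simps)
  have kx: "real (Suc k) * x \<le> 1 / 4"
    using x mult_left_mono[OF x(3), of "real (Suc k)"] by linarith
  note dominant = near_imp_diag_dominant[OF near U V e ke]
  have Um: "1 / 2 \<le> \<bar>U (k - Suc m) m\<bar>" using dominant(1) m by (simp add: diag_dominant_def)
  have Vm: "1 / 2 \<le> \<bar>V m m\<bar>" using dominant(2) m by (simp add: diag_dominant_def)
  have "sgn (\<Sum>j<k. U (k - Suc m) j * X j (Suc m)) = sgn (U (k - Suc m) m) * sgn (X m (Suc m))"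
    using near X_abs_le_1[of _ "Suc m"] m Um X_dominant[OF m x(1,2) kx]
    by (intro sgn_sum_dominant[OF m _ _ e ke]) (auto simp: near_signed_perm_def)
  then show "sgn (bordered k U X0 X (k - Suc m) (Suc m)) = - sgn (s m) * sgn (U (k - Suc m) m)"
    using m sgn_X[OF m] by (simp add: bordered_def)
  have "sgn (\<Sum>j<k. V m j * Y j m) = sgn (V m m) * sgn (Y m m)"
    using near Y_abs_le_1[of _ m] m Vm Y_dominant[OF m x(1,2) kx]
    by (intro sgn_sum_dominant[OF m _ _ e ke]) (auto simp: near_signed_perm_def)
  then show "sgn (bordered k V Y0 Y m m) = sgn (s m) * sgn (V m m)"
    using m sgn_Y[OF m] by (simp add: bordered_def)
qed

lemma sgn_corner: "sgn (bordered k U X0 X k 0) = 1"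
  using len_pos[of 0] by (simp add: bordered_def X0_def)

end

context separated
begin

text \<open>
  In the basis of left singular vectors, the eigenvector equation has the components
  \<open>(nu\<^sub>i - mu\<^sub>l) z\<^sub>l = w\<^sub>l y\<^sub>k\<close>. The last coordinate \<open>y\<^sub>k\<close> cannot vanish, for then all \<open>z\<^sub>l\<close> would; so the
  \<open>z\<^sub>l\<close> can be eliminated from the equation of the last row.
\<close>

lemma spectrum_imp_secular:
  assumes svd: "svd k B U V mu" and col: "\<And>p. p < k \<Longrightarrow> B p k = 0"
    and spec: "gram_spectrum (Suc k) B nu" and i: "i \<le> k"
  defines "s \<equiv> \<lambda>j. \<Sum>q<k. B k q * V q j"
  shows "nu i - ((B k k)\<^sup>2 + (\<Sum>j<k. (s j)\<^sup>2)) - (\<Sum>j<k. mu j * (s j)\<^sup>2 / (nu i - mu j)) = 0"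
proof -
  have U: "ortho k U" and V: "ortho k V" using svd by (auto simp: svd_def)
  have mu: "0 \<le> mu j" if "j < k" for j using mu_pos[OF that] by simp
  have row: "B k q = (\<Sum>j<k. V q j * s j)" if "q < k" for q
    unfolding s_def using ortho_row_expansion[OF V that, of "B k"] by (simp add: mult_ac)
  define w where "w j = sqrt (mu j) * s j" for j
  obtain y where y: "\<exists>p<Suc k. y p \<noteq> 0"
    and ev: "\<And>p. p < Suc k \<Longrightarrow> (\<Sum>q<Suc k. gram (Suc k) B p q * y q) = nu i * y p"
    using spec i unfolding gram_spectrum_def by (metis less_Suc_eq_le)
  define z where "z j = (\<Sum>q<k. U q j * y q)" for j
  have g1: "gram (Suc k) B p q = gram k B p q" if "p < k" "q < k" for p q
    using col that by (simp add: gram_def)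
  have g2: "gram (Suc k) B p k = (\<Sum>j<k. U p j * w j)" if "p < k" for p
  proof -
    have "gram (Suc k) B p k = (\<Sum>l<k. (\<Sum>j<k. V l j * (U p j * sqrt (mu j))) * (\<Sum>j<k. V l j * s j))"
      using col that svd by (simp add: gram_def svd_def row mult_ac)
    also have "\<dots> = (\<Sum>j<k. U p j * sqrt (mu j) * s j)" by (rule ortho_inner[OF V])
    finally show ?thesis by (simp add: w_def mult.assoc)
  qed
  have g2': "gram (Suc k) B k p = gram (Suc k) B p k" for p
    by (simp add: gram_def mult.commute)
  have g3: "gram (Suc k) B k k = (\<Sum>j<k. (s j)\<^sup>2) + (B k k)\<^sup>2"
    using ortho_inner[OF V, of s s] by (simp add: gram_def row power2_eq_square)
  have zl: "(nu i - mu l) * z l = w l * y k" if l: "l < k" for l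
  proof -
    have "(\<Sum>j<k. U p j * (mu j * z j + w j * y k)) = nu i * y p" if p: "p < k" for p
    proof -
      have "nu i * y p = (\<Sum>q<k. gram k B p q * y q) + (\<Sum>j<k. U p j * w j) * y k"
        using ev[of p] p by (simp add: g1 g2)
      also have "(\<Sum>q<k. gram k B p q * y q) = (\<Sum>j<k. U p j * (mu j * z j))"
        unfolding z_def by (rule svd_gram_apply[OF svd mu p])
      finally show ?thesis by (simp add: sum.distrib sum_distrib_left sum_distrib_right algebra_simps)
    qed
    then have "(\<Sum>p<k. U p l * (\<Sum>j<k. U p j * (mu j * z j + w j * y k))) = (\<Sum>p<k. U p l * (nu i * y p))"
      by simp
    then have "mu l * z l + w l * y k = nu i * z l"
      unfolding ortho_column_coeff[OF U l] by (simp add: z_def sum_distrib_left mult_ac)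
    then show ?thesis by (simp add: algebra_simps)
  qed
  have ne: "nu i - mu l \<noteq> 0" if "l < k" for l using nu_neq_mu[OF i that] by simp
  have yk: "y k \<noteq> 0"
  proof
    assume 0: "y k = 0"
    then have "z l = 0" if "l < k" for l using zl[OF that] ne[OF that] by simp
    then have "y p = 0" if "p < k" for p
      using ortho_row_expansion[OF U that, of y] by (simp add: z_def mult.commute)
    then show False using y 0 by (auto simp: less_Suc_eq)
  qed
  have "(\<Sum>p<k. gram (Suc k) B k p * y p) = (\<Sum>j<k. w j * z j)"
  proof -
    have "(\<Sum>p<k. gram (Suc k) B k p * y p) = (\<Sum>p<k. \<Sum>j<k. w j * (U p j * y p))"
      by (intro sum.cong refl) (simp add: g2' g2 sum_distrib_left sum_distrib_right mult_ac)
    also have "\<dots> = (\<Sum>j<k. \<Sum>p<k. w j * (U p j * y p))" by (rule sum.swap)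
    finally show ?thesis by (simp add: z_def sum_distrib_left)
  qed
  also have "\<dots> = (\<Sum>j<k. mu j * (s j)\<^sup>2 / (nu i - mu j)) * y k"
    unfolding sum_distrib_right
  proof (intro sum.cong refl)
    fix j assume "j \<in> {..<k}"
    then have j: "j < k" by simp
    have "z j = w j * y k / (nu i - mu j)" using zl[OF j] ne[OF j] by (simp add: field_simps)
    moreover have "w j * w j = mu j * (s j)\<^sup>2"
      using mu[OF j] by (simp add: w_def power2_eq_square mult_ac)
    ultimately show "w j * z j = mu j * (s j)\<^sup>2 / (nu i - mu j) * y k"
      by (simp add: mult_ac) 
  qed
  finally have "(\<Sum>j<k. mu j * (s j)\<^sup>2 / (nu i - mu j)) * y k + ((\<Sum>j<k. (s j)\<^sup>2) + (B k k)\<^sup>2) * y k = nu i * y k"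
    using ev[of k] by (simp add: g3)
  then have "(nu i - ((B k k)\<^sup>2 + (\<Sum>j<k. (s j)\<^sup>2)) - (\<Sum>j<k. mu j * (s j)\<^sup>2 / (nu i - mu j))) * y k = 0"
    by (simp add: algebra_simps)
  then show ?thesis using yk by simp
qed

end

section \<open>Signs of nearly diagonal determinants\<close>

text \<open>
  The sign \<open>(-1)\<^bsup>i(i-1)/2\<^esup>\<close> of the permutation reversing \<open>i\<close> indices. It is kept as a determinant
  because only its square matters.
\<close>

definition reversal_det :: "nat \<Rightarrow> real" where
  "reversal_det i = det (mat i i (\<lambda>(p, q). if Suc (p + q) = i then 1 else 0))"

lemma reversal_det_square: "reversal_det i * reversal_det i = 1"
proof -
  define J :: "real mat" where "J = mat i i (\<lambda>(p, q). if Suc (p + q) = i then 1 else 0)"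
  have J: "J \<in> carrier_mat i i" by (simp add: J_def)
  have "J * J = 1\<^sub>m i"
  proof (rule eq_matI)
    fix p q assume "p < dim_row (1\<^sub>m i :: real mat)" "q < dim_col (1\<^sub>m i :: real mat)"
    then have pq: "p < i" "q < i" by auto
    have "(J * J) $$ (p, q) = (\<Sum>l<i. (if l = i - 1 - p then 1 else 0) * (if Suc (l + q) = i then 1 else 0))"
      using pq by (auto simp: J_def scalar_prod_def atLeast0LessThan intro!: sum.cong)
    also have "\<dots> = (if Suc (i - 1 - p + q) = i then 1 else 0)"
      using pq by (simp add: if_distrib[of "\<lambda>x. x * _"] cong: if_cong)
    also have "\<dots> = (1\<^sub>m i :: real mat) $$ (p, q)" using pq by auto
    finally show "(J * J) $$ (p, q) = (1\<^sub>m i :: real mat) $$ (p, q)" .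
  qed (use J in auto)
  then have "det J * det J = 1" using det_mult[OF J J] by simp
  then show ?thesis by (simp add: reversal_det_def J_def)
qed

lemma det_reverse_columns:
  fixes f :: "nat \<Rightarrow> nat \<Rightarrow> real"
  shows "det (mat i i (\<lambda>(p, q). f p (i - 1 - q))) = reversal_det i * det (mat i i (\<lambda>(p, q). f p q))"
proof -
  define J :: "real mat" where "J = mat i i (\<lambda>(p, q). if Suc (p + q) = i then 1 else 0)"
  define M where "M = mat i i (\<lambda>(p, q). f p q)"
  have "mat i i (\<lambda>(p, q). f p (i - 1 - q)) = M * J"
  proof (rule eq_matI)
    fix p q assume "p < dim_row (M * J)" "q < dim_col (M * J)"
    then have pq: "p < i" "q < i" by (auto simp: M_def J_def)
    have "(M * J) $$ (p, q) = (\<Sum>l<i. f p l * (if l = i - 1 - q then 1 else 0))"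
      using pq by (auto simp: J_def M_def scalar_prod_def atLeast0LessThan intro!: sum.cong)
    also have "\<dots> = f p (i - 1 - q)" using pq by (simp add: if_distrib cong: if_cong)
    finally show "mat i i (\<lambda>(p, q). f p (i - 1 - q)) $$ (p, q) = (M * J) $$ (p, q)" using pq by simp
  qed (auto simp: M_def J_def)
  then show ?thesis
    by (subst \<open>_ = M * J\<close>, subst det_mult[of _ i]) (auto simp: M_def J_def reversal_det_def)
qed

lemma exists_max_abs:
  fixes f :: "nat \<Rightarrow> real"
  assumes "0 < i" obtains p where "p < i" "\<And>q. q < i \<Longrightarrow> \<bar>f q\<bar> \<le> \<bar>f p\<bar>"
proof -
  have fin: "finite ((\<lambda>q. \<bar>f q\<bar>) ` {..<i})" and ne: "(\<lambda>q. \<bar>f q\<bar>) ` {..<i} \<noteq> {}"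
    using assms by auto
  obtain p where p: "p < i" "Max ((\<lambda>q. \<bar>f q\<bar>) ` {..<i}) = \<bar>f p\<bar>"
    using Max_in[OF fin ne] by auto
  then have "\<bar>f q\<bar> \<le> \<bar>f p\<bar>" if "q < i" for q
    using Max_ge[OF fin, of "\<bar>f q\<bar>"] that by auto
  then show ?thesis using that p by blast
qed

lemma small_combination:
  fixes c y :: "nat \<Rightarrow> real"
  assumes "finite S" "\<And>j. j \<in> S \<Longrightarrow> \<bar>c j\<bar> \<le> e" "\<And>j. j \<in> S \<Longrightarrow> \<bar>y j\<bar> \<le> m"
    and "card S \<le> k" "real k * e \<le> 1 / 8" "0 \<le> e" "0 \<le> m"
  shows "\<bar>\<Sum>j\<in>S. c j * y j\<bar> \<le> m / 8"
proof -
  have "\<bar>\<Sum>j\<in>S. c j * y j\<bar> \<le> (\<Sum>j\<in>S. \<bar>c j * y j\<bar>)" by (rule sum_abs)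
  also have "\<dots> \<le> (\<Sum>j\<in>S. e * m)"
    using assms by (intro sum_mono) (auto simp: abs_mult intro!: mult_mono)
  also have "\<dots> = real (card S) * e * m" by simp
  also have "\<dots> \<le> real k * e * m" using assms by (intro mult_right_mono) auto
  also have "\<dots> \<le> 1 / 8 * m" using assms by (intro mult_right_mono) auto
  finally show ?thesis by simp
qed

text \<open>
  Let \<open>x\<close> be in the kernel, \<open>g = W\<^sup>T x\<close> and \<open>y = \<sigma> g\<close>, so that \<open>A y = 0\<close>. The coordinates of \<open>g\<close>
  with index below \<open>i\<close> are comparable to \<open>x\<close> and the others are small, and \<open>\<sigma>\<close> decreases, so the
  largest coordinate of \<open>y\<close> has an index below \<open>i\<close>. In that row of \<open>A y = 0\<close> the diagonal term cannot
  be cancelled.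
\<close>

lemma det_dominant_nonzero:
  assumes A: "diag_dominant i k e A" and W: "diag_dominant i k e W"
    and e: "0 \<le> e" "real k * e \<le> 1 / 8" and i: "i \<le> k"
    and sig: "\<And>j. j < k \<Longrightarrow> 0 < \<sigma> j" "\<And>j l. j \<le> l \<Longrightarrow> l < k \<Longrightarrow> \<sigma> l \<le> \<sigma> j"
  shows "det (mat i i (\<lambda>(p, q). \<Sum>j<k. A p j * \<sigma> j * W q j)) \<noteq> (0 :: real)"
proof
  define M where "M = mat i i (\<lambda>(p, q). \<Sum>j<k. A p j * \<sigma> j * W q j)"
  assume "det (mat i i (\<lambda>(p, q). \<Sum>j<k. A p j * \<sigma> j * W q j)) = 0"
  then have "det M = 0" by (simp add: M_def)
  then obtain v where v: "v \<in> carrier_vec i" "v \<noteq> 0\<^sub>v i" "M *\<^sub>v v = 0\<^sub>v i"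
    using det_0_iff_vec_prod_zero_field[of M i] by (auto simp: M_def)
  define x where "x q = v $ q" for q
  define g where "g j = (\<Sum>q<i. W q j * x q)" for j
  define y where "y j = \<sigma> j * g j" for j
  have row: "(\<Sum>j<k. A p j * y j) = 0" if p: "p < i" for p
  proof -
    have "0 = (M *\<^sub>v v) $ p" using v p by simp
    also have "\<dots> = (\<Sum>q<i. \<Sum>j<k. A p j * \<sigma> j * W q j * x q)"
      using p v(1) by (simp add: M_def scalar_prod_def atLeast0LessThan x_def sum_distrib_right)
    also have "\<dots> = (\<Sum>j<k. \<Sum>q<i. A p j * \<sigma> j * W q j * x q)" by (rule sum.swap)
    also have "\<dots> = (\<Sum>j<k. A p j * y j)"
      by (simp add: y_def g_def sum_distrib_left mult.assoc)
    finally show ?thesis by simp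
  qed
  obtain q1 where q1: "q1 < i" "x q1 \<noteq> 0"
    using v(1,2) by (metis eq_vecI carrier_vecD index_zero_vec x_def)
  then have "0 < i" by simp
  then obtain q0 where q0: "q0 < i" "\<And>q. q < i \<Longrightarrow> \<bar>x q\<bar> \<le> \<bar>x q0\<bar>"
    using exists_max_abs[of i x] by metis
  have x0: "0 < \<bar>x q0\<bar>" using q0(2)[OF q1(1)] q1(2) by simp
  \<comment> \<open>\<open>3 / 8 = 1 / 2 - 1 / 8\<close>: dominant coefficient minus the sum of the small ones\<close>
  have g0: "3 / 8 * \<bar>x q0\<bar> \<le> \<bar>g q0\<bar>"
  proof -
    have "\<bar>\<Sum>q\<in>{..<i}-{q0}. W q q0 * x q\<bar> \<le> \<bar>x q0\<bar> / 8"
      using W q0 i e by (intro small_combination[where e = e and k = k]) (auto simp: diag_dominant_def)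
    moreover have "g q0 = W q0 q0 * x q0 + (\<Sum>q\<in>{..<i}-{q0}. W q q0 * x q)"
      unfolding g_def using q0(1) by (intro sum.remove) auto
    moreover have "1 / 2 * \<bar>x q0\<bar> \<le> \<bar>W q0 q0 * x q0\<bar>"
      unfolding abs_mult using W q0(1) by (intro mult_right_mono) (auto simp: diag_dominant_def)
    ultimately show ?thesis by linarith
  qed
  obtain p0 where p0: "p0 < i" "\<And>p. p < i \<Longrightarrow> \<bar>y p\<bar> \<le> \<bar>y p0\<bar>"
    using \<open>0 < i\<close> exists_max_abs[of i y] by metis
  have yq: "\<bar>y q0\<bar> = \<sigma> q0 * \<bar>g q0\<bar>" using sig(1)[of q0] q0 i by (simp add: y_def abs_mult)
  have "0 < \<bar>y q0\<bar>" unfolding yq using sig(1)[of q0] q0 i g0 x0 by (intro mult_pos_pos) auto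
  then have y0: "0 < \<bar>y p0\<bar>" using p0(2)[OF q0(1)] by linarith
  have ally: "\<bar>y j\<bar> \<le> \<bar>y p0\<bar>" if j: "j < k" for j
  proof (cases "j < i")
    case False
    have "\<bar>g j\<bar> \<le> \<bar>x q0\<bar> / 8"
      unfolding g_def using W q0 i e j False
      by (intro small_combination[where e = e and k = k]) (auto simp: diag_dominant_def)
    then have "\<bar>g j\<bar> \<le> \<bar>g q0\<bar>" using g0 x0 by linarith
    then have "\<sigma> j * \<bar>g j\<bar> \<le> \<sigma> q0 * \<bar>g q0\<bar>"
      using sig(1)[OF j] sig(2)[of q0 j] q0 False j by (intro mult_mono) auto
    moreover have "\<bar>y j\<bar> = \<sigma> j * \<bar>g j\<bar>" using sig(1)[OF j] by (simp add: y_def abs_mult)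
    ultimately have "\<bar>y j\<bar> \<le> \<bar>y q0\<bar>" using yq by linarith
    then show ?thesis using p0(2)[OF q0(1)] by linarith
  qed (use p0 in auto)
  have "\<bar>\<Sum>j\<in>{..<k}-{p0}. A p0 j * y j\<bar> \<le> \<bar>y p0\<bar> / 8"
    using A p0 i e ally by (intro small_combination[where e = e and k = k]) (auto simp: diag_dominant_def)
  moreover have "(\<Sum>j<k. A p0 j * y j) = A p0 p0 * y p0 + (\<Sum>j\<in>{..<k}-{p0}. A p0 j * y j)"
    using p0(1) i by (intro sum.remove) auto
  moreover have "1 / 2 * \<bar>y p0\<bar> \<le> \<bar>A p0 p0 * y p0\<bar>"
    unfolding abs_mult using A p0(1) by (intro mult_right_mono) (auto simp: diag_dominant_def)
  ultimately show False using row[OF p0(1)] y0 by linarith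
qed

lemma det_expand:
  fixes F :: "nat \<Rightarrow> nat \<Rightarrow> real"
  shows "det (mat i i (\<lambda>(p, q). F p q))
    = (\<Sum>\<pi> | \<pi> permutes {0..<i}. signof \<pi> * (\<Prod>p = 0..<i. F p (\<pi> p)))"
proof -
  have "det (mat i i (\<lambda>(p, q). F p q))
    = (\<Sum>\<pi> | \<pi> permutes {0..<i}. signof \<pi> * (\<Prod>p = 0..<i. mat i i (\<lambda>(p, q). F p q) $$ (p, \<pi> p)))"
    by (rule det_def') simp
  also have "\<dots> = (\<Sum>\<pi> | \<pi> permutes {0..<i}. signof \<pi> * (\<Prod>p = 0..<i. F p (\<pi> p)))"
  proof (intro sum.cong refl arg_cong2[where f = "(*)"] prod.cong)
    fix \<pi> p assume "\<pi> \<in> {\<pi>. \<pi> permutes {0..<i}}" "p \<in> {0..<i}"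
    then have "\<pi> p < i" "p < i" using permutes_in_image[of \<pi> "{0..<i}" p] by auto
    then show "mat i i (\<lambda>(p, q). F p q) $$ (p, \<pi> p) = F p (\<pi> p)" by simp
  qed
  finally show ?thesis .
qed

lemma det_diagonal:
  fixes c :: "nat \<Rightarrow> real"
  shows "det (mat i i (\<lambda>(p, q). if p = q then c p else 0)) = (\<Prod>p<i. c p)"
proof -
  have "det (mat i i (\<lambda>(p, q). if p = q then c p else 0))
      = prod_list (diag_mat (mat i i (\<lambda>(p, q). if p = q then c p else 0)))"
    by (rule det_upper_triangular) (auto simp: upper_triangular_def)
  also have "diag_mat (mat i i (\<lambda>(p, q). if p = q then c p else 0)) = map c [0..<i]"
    by (auto simp: diag_mat_def)
  also have "prod_list (map c [0..<i]) = (\<Prod>p<i. c p)"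
    by (induction i) (auto simp: mult.commute)
  finally show ?thesis .
qed

lemma sgn_prod_real: "sgn (\<Prod>p\<in>S. f p) = (\<Prod>p\<in>S. sgn (f p :: real))"
  by (induction S rule: infinite_finite_induct) (auto simp: sgn_mult)

text \<open>
  Shrinking all off-diagonal entries to 0 keeps the hypotheses of \<open>det_dominant_nonzero\<close>, so the
  determinant does not change its sign on the way to the diagonal case.
\<close>

lemma sgn_det_dominant:
  assumes A: "diag_dominant i k e A" and W: "diag_dominant i k e W"
    and e: "0 \<le> e" "real k * e \<le> 1 / 8" and i: "i \<le> k"
    and sig: "\<And>j. j < k \<Longrightarrow> 0 < \<sigma> j" "\<And>j l. j \<le> l \<Longrightarrow> l < k \<Longrightarrow> \<sigma> l \<le> \<sigma> j"
  shows "sgn (det (mat i i (\<lambda>(p, q). \<Sum>j<k. A p j * \<sigma> j * W q j))) = (\<Prod>p<i. sgn (A p p) * sgn (W p p))"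
proof -
  define T :: "(nat \<Rightarrow> nat \<Rightarrow> real) \<Rightarrow> real \<Rightarrow> nat \<Rightarrow> nat \<Rightarrow> real"
    where "T C \<tau> p j = (if j = p then C p p else \<tau> * C p j)" for C \<tau> p j
  define h where "h \<tau> = det (mat i i (\<lambda>(p, q). \<Sum>j<k. T A \<tau> p j * \<sigma> j * T W \<tau> q j))" for \<tau>
  have T1: "T C 1 = C" for C by (intro ext) (simp add: T_def)
  have dom: "diag_dominant i k e (T C \<tau>)" if "diag_dominant i k e C" "0 \<le> \<tau>" "\<tau> \<le> 1" for C \<tau>
  proof -
    have "\<bar>\<tau> * c\<bar> \<le> e" if "\<bar>c\<bar> \<le> e" for c
      using that \<open>0 \<le> \<tau>\<close> \<open>\<tau> \<le> 1\<close> mult_mono[of "\<bar>\<tau>\<bar>" 1 "\<bar>c\<bar>" e] by (simp add: abs_mult)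
    then show ?thesis using that(1) by (auto simp: diag_dominant_def T_def)
  qed
  have nz: "h \<tau> \<noteq> 0" if "0 \<le> \<tau>" "\<tau> \<le> 1" for \<tau>
    unfolding h_def using dom[OF A that] dom[OF W that] e i sig by (rule det_dominant_nonzero)
  have cont: "continuous_on {0..1} h"
  proof -
    have T: "continuous_on {0..1} (\<lambda>\<tau>. T C \<tau> p j)" for C p j
      unfolding T_def by (cases "j = p") (auto intro!: continuous_intros)
    show ?thesis unfolding h_def det_expand by (intro continuous_intros T)
  qed
  have same: "sgn (h 1) = sgn (h 0)"
  proof (rule ccontr)
    assume neq: "sgn (h 1) \<noteq> sgn (h 0)"
    have "h 0 \<noteq> 0" "h 1 \<noteq> 0" using nz by auto
    then have "h 0 < 0 \<and> 0 < h 1 \<or> h 1 < 0 \<and> 0 < h 0"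
      using neq by (metis linorder_neqE_linordered_idom sgn_neg sgn_pos)
    then consider "h 0 \<le> 0" "0 \<le> h 1" | "h 1 \<le> 0" "0 \<le> h 0" by fastforce
    then show False
    proof cases
      case 1
      then obtain \<tau> where "0 \<le> \<tau>" "\<tau> \<le> 1" "h \<tau> = 0" using IVT'[of h 0 0 1] cont by auto
      then show False using nz by auto
    next
      case 2
      then obtain \<tau> where "0 \<le> \<tau>" "\<tau> \<le> 1" "h \<tau> = 0" using IVT2'[of h 1 0 0] cont by auto
      then show False using nz by auto
    qed
  qed
  have "(\<Sum>j<k. T A 0 p j * \<sigma> j * T W 0 q j) = (if p = q then A p p * \<sigma> p * W p p else 0)"
    if "p < i" "q < i" for p q
  proof -
    have "(\<Sum>j<k. T A 0 p j * \<sigma> j * T W 0 q j)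
        = (\<Sum>j<k. if j = p then (if p = q then A p p * \<sigma> p * W p p else 0) else 0)"
      by (intro sum.cong refl) (auto simp: T_def)
    then show ?thesis using that i by simp
  qed
  then have "h 0 = det (mat i i (\<lambda>(p, q). if p = q then A p p * \<sigma> p * W p p else 0))"
    unfolding h_def by (intro arg_cong[where f = det] cong_mat) auto
  then have "sgn (h 0) = (\<Prod>p<i. sgn (A p p * \<sigma> p * W p p))"
    by (simp only: det_diagonal sgn_prod_real)
  also have "\<dots> = (\<Prod>p<i. sgn (A p p) * sgn (W p p))"
    using sig(1) i by (intro prod.cong refl) (auto simp: sgn_mult)
  finally show ?thesis using same by (simp add: h_def T1)
qed

section \<open>Corner minors\<close>

text \<open>
  The minor \<open>\<Delta>\<^sub>i\<^bsup>(k)\<^esup>\<close> with rows and columns counted from the bottom right corner.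
\<close>

definition minor :: "nat \<Rightarrow> nat \<Rightarrow> (nat \<Rightarrow> nat \<Rightarrow> real) \<Rightarrow> real" where
  "minor k i B = det (mat i i (\<lambda>(p, q). B (k - 1 - p) (i - 1 - q)))"

lemma diag_dominant_mono: "diag_dominant k k e A \<Longrightarrow> i \<le> k \<Longrightarrow> diag_dominant i k e A"
  by (auto simp: diag_dominant_def)

lemma sgn_minor:
  assumes svd: "svd k B U V mu" and near: "near_signed_perm k e U V"
    and e: "0 \<le> e" "real k * e \<le> 1 / 8" and i: "i \<le> k"
    and mu: "\<And>j. j < k \<Longrightarrow> 0 < mu j" "\<And>j l. j \<le> l \<Longrightarrow> l < k \<Longrightarrow> mu l \<le> mu j"
  shows "sgn (minor k i B) = sgn (reversal_det i) * (\<Prod>p<i. sgn (U (k - 1 - p) p) * sgn (V p p))"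
proof -
  have U: "ortho k U" and V: "ortho k V" using svd by (auto simp: svd_def)
  define f where "f p q = (\<Sum>j<k. U (k - 1 - p) j * sqrt (mu j) * V q j)" for p q
  have "minor k i B = det (mat i i (\<lambda>(p, q). f p (i - 1 - q)))"
    unfolding minor_def using svd i
    by (intro arg_cong[where f = det] cong_mat) (auto simp: f_def svd_def)
  also have "\<dots> = reversal_det i * det (mat i i (\<lambda>(p, q). f p q))" by (rule det_reverse_columns)
  finally have "sgn (minor k i B) = sgn (reversal_det i) * sgn (det (mat i i (\<lambda>(p, q). f p q)))"
    by (simp add: sgn_mult)
  moreover have "sgn (det (mat i i (\<lambda>(p, q). f p q))) = (\<Prod>p<i. sgn (U (k - 1 - p) p) * sgn (V p p))"
    unfolding f_def
    using near_imp_diag_dominant[OF near U V e, THEN diag_dominant_mono, OF i] e i mu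
    by (intro sgn_det_dominant[of i k e]) auto
  ultimately show ?thesis by simp
qed

text \<open>
  The factor by which the signs of the minors in a new row differ from the signs of the new
  coordinates. It depends on the old block only, and this is what makes the induction work.
\<close>

definition row_sign :: "nat \<Rightarrow> (nat \<Rightarrow> nat \<Rightarrow> real) \<Rightarrow> (nat \<Rightarrow> nat \<Rightarrow> real) \<Rightarrow> nat \<Rightarrow> real" where
  "row_sign k U V m = sgn (reversal_det (Suc m))
     * (\<Prod>p<m. - (sgn (U (k - 1 - p) p) * sgn (V p p))) * sgn (V m m)"

lemma row_sign_square:
  assumes near: "near_signed_perm k e U V" and U: "ortho k U" and V: "ortho k V"
    and e: "0 \<le> e" "real k * e \<le> 1 / 8" and m: "m < k"
  shows "row_sign k U V m * row_sign k U V m = 1"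
proof -
  have sq: "sgn x * sgn x = 1" if "x \<noteq> 0" for x :: real
    using that by (cases "0 < x") auto
  have nz: "U (k - 1 - p) p \<noteq> 0" "V p p \<noteq> 0" if "p < k" for p
    using near_imp_diag_dominant[OF near U V e] that by (force simp: diag_dominant_def)+
  have "reversal_det (Suc m) \<noteq> 0" using reversal_det_square[of "Suc m"] by auto
  moreover have "(\<Prod>p<m. - (sgn (U (k - 1 - p) p) * sgn (V p p)))
      * (\<Prod>p<m. - (sgn (U (k - 1 - p) p) * sgn (V p p))) = 1"
    unfolding prod.distrib[symmetric]
  proof (rule prod.neutral, rule ballI)
    fix p assume "p \<in> {..<m}"
    then have "sgn (U (k - 1 - p) p) * sgn (U (k - 1 - p) p) = 1" "sgn (V p p) * sgn (V p p) = 1"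
      using sq nz m by auto
    then show "- (sgn (U (k - 1 - p) p) * sgn (V p p)) * - (sgn (U (k - 1 - p) p) * sgn (V p p)) = 1"
      by (simp only: minus_mult_minus mult.assoc mult.left_commute mult_1_right)
  qed
  moreover have "(a * b * c) * (a * b * c) = (a * a) * (b * b) * (c * c)" for a b c :: real by simp
  moreover have "sgn (reversal_det (Suc m)) * sgn (reversal_det (Suc m)) = 1" "sgn (V m m) * sgn (V m m) = 1"
    using sq nz m calculation(1) by auto
  ultimately show ?thesis unfolding row_sign_def by (simp only: mult_1)
qed

context bordering
begin

lemma s_nonzero: "m < k \<Longrightarrow> s m \<noteq> 0"
  using s_sq[of m] weight_pos[of m] mu_pos[of m] by auto

text \<open>
  Each pair of dominant entries with index \<open>p < m\<close> contributes \<open>(sgn s\<^sub>p)\<^sup>2 = 1\<close>, because the shift in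
  \<open>X\<close> delays the sign of \<open>s\<^sub>p\<close> by one index compared with \<open>Y\<close>. Only the sign of \<open>s\<^sub>m\<close> survives.
\<close>

lemma sgn_minor_step:
  assumes svd: "svd k B U V mu" and near: "near_signed_perm k e U V"
    and row: "\<And>q. q < k \<Longrightarrow> B k q = (\<Sum>j<k. s j * V q j)" and "B k k = d"
    and col: "\<And>p. p < k \<Longrightarrow> B p k = 0"
    and x: "err \<le> x\<^sup>2" "0 \<le> x" "x \<le> e" and e: "real (Suc k) * (real (Suc k) * e) \<le> 1 / 8" and m: "m < k"
  shows "sgn (minor (Suc k) (Suc m) B) = sgn (s m) * row_sign k U V m"
proof -
  have U: "ortho k U" and V: "ortho k V" using svd by (auto simp: svd_def)
  define U' where "U' = bordered k U X0 X"
  define V' where "V' = bordered k V Y0 Y"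
  have e0: "0 \<le> real (Suc k) * e" using x by simp
  have "1 * (real (Suc k) * e) \<le> real (Suc k) * (real (Suc k) * e)"
    using e0 by (intro mult_right_mono) auto
  then have e1: "real (Suc k) * e \<le> 1 / 8" using e by linarith
  note diag = sgn_diagonal_step[OF near U V x e1, folded U'_def V'_def]
  \<comment> \<open>The entry with index 0 comes from the new coordinate and is positive; the others are shifted by one.\<close>
  have U0: "sgn (U' k 0) = 1" unfolding U'_def by (rule sgn_corner)
  have s2: "sgn (s p) * sgn (s p) = 1" if "p < k" for p
    using s_nonzero[OF that] by (cases "0 < s p") auto
  have "sgn (minor (Suc k) (Suc m) B)
      = sgn (reversal_det (Suc m)) * (\<Prod>p<Suc m. sgn (U' (Suc k - 1 - p) p) * sgn (V' p p))"
    using svd_step[OF svd row \<open>B k k = d\<close> col] near_step[OF near U V x] nu_antimono nu_pos m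
    unfolding U'_def V'_def by (intro sgn_minor[OF _ _ e0 e]) (auto simp: less_Suc_eq_le)
  also have "(\<Prod>p<Suc m. sgn (U' (Suc k - 1 - p) p) * sgn (V' p p))
      = (\<Prod>p<Suc m. sgn (U' (k - p) p)) * (\<Prod>p<Suc m. sgn (V' p p))"
    by (simp only: prod.distrib diff_Suc_1)
  also have "(\<Prod>p<Suc m. sgn (U' (k - p) p)) = (\<Prod>p<m. - sgn (s p) * sgn (U (k - 1 - p) p))"
    unfolding prod.lessThan_Suc_shift using U0 diag(1) m by simp
  also have "(\<Prod>p<Suc m. sgn (V' p p)) = (\<Prod>p<m. sgn (s p) * sgn (V p p)) * (sgn (s m) * sgn (V m m))"
    using diag(2) m by simp
  also have "(\<Prod>p<m. - sgn (s p) * sgn (U (k - 1 - p) p)) * ((\<Prod>p<m. sgn (s p) * sgn (V p p)) * (sgn (s m) * sgn (V m m)))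
      = (\<Prod>p<m. (- sgn (s p) * sgn (U (k - 1 - p) p)) * (sgn (s p) * sgn (V p p))) * (sgn (s m) * sgn (V m m))"
    by (simp only: prod.distrib mult.assoc)
  also have "(\<Prod>p<m. (- sgn (s p) * sgn (U (k - 1 - p) p)) * (sgn (s p) * sgn (V p p)))
      = (\<Prod>p<m. - (sgn (U (k - 1 - p) p) * sgn (V p p)))"
  proof (rule prod.cong[OF refl])
    fix p assume "p \<in> {..<m}"
    then have "sgn (s p) * sgn (s p) = 1" using s2 m by simp
    moreover have "(- a * u) * (a * v) = - ((a * a) * (u * v))" for a u v :: real by simp
    ultimately show "(- sgn (s p) * sgn (U (k - 1 - p) p)) * (sgn (s p) * sgn (V p p))
        = - (sgn (U (k - 1 - p) p) * sgn (V p p))" by (metis mult_1)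
  qed
  finally show ?thesis unfolding row_sign_def by (simp only: mult_ac)
qed

end

section \<open>Building the blocks one row at a time\<close>

lemma gram_spectrum_cong:
  assumes "\<And>p q. p < k \<Longrightarrow> q < k \<Longrightarrow> B p q = B' p q"
  shows "gram_spectrum k B mu = gram_spectrum k B' mu"
proof -
  have "gram k B p q = gram k B' p q" if "p < k" "q < k" for p q
    using that assms by (simp add: gram_def)
  then show ?thesis by (simp add: gram_spectrum_def cong: conj_cong)
qed

lemma minor_cong:
  assumes "\<And>p q. p < k \<Longrightarrow> q < k \<Longrightarrow> B p q = B' p q" "i \<le> k"
  shows "minor k i B = minor k i B'"
  unfolding minor_def using assms by (intro arg_cong[where f = det] cong_mat) auto

lemma svd_cong:
  assumes "\<And>p q. p < k \<Longrightarrow> q < k \<Longrightarrow> B p q = B' p q"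
  shows "svd k B U V mu = svd k B' U V mu"
  unfolding svd_def using assms by simp

text \<open>
  The conditions on the block of size \<open>k\<close>: it comes from \<open>AN_real\<close>, all smaller blocks have the
  prescribed spectra, and the minors have the prescribed signs.
\<close>

definition admissible :: "(nat \<Rightarrow> nat \<Rightarrow> real) \<Rightarrow> (nat \<Rightarrow> nat \<Rightarrow> real) \<Rightarrow> nat \<Rightarrow> (nat \<Rightarrow> nat \<Rightarrow> real) \<Rightarrow> bool" where
  "admissible spec sg k B \<longleftrightarrow>
     (\<forall>p<k. 0 < B p p) \<and> (\<forall>p<k. \<forall>q<k. p < q \<longrightarrow> B p q = 0) \<and>
     (\<forall>j\<le>k. gram_spectrum j B (spec j)) \<and>
     (\<forall>j\<le>k. \<forall>i. 1 \<le> i \<and> i < j \<longrightarrow> sgn (minor j i B) = sg i j)"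

lemma admissible_SucD: "admissible spec sg (Suc k) B \<Longrightarrow> admissible spec sg k B"
  unfolding admissible_def by auto

lemma admissible_cong:
  assumes eq: "\<And>p q. p < k \<Longrightarrow> q < k \<Longrightarrow> B p q = B' p q"
  shows "admissible spec sg k B = admissible spec sg k B'"
proof -
  have "gram_spectrum j B (spec j) = gram_spectrum j B' (spec j)" if "j \<le> k" for j
    using that by (intro gram_spectrum_cong eq) auto
  moreover have "minor j i B = minor j i B'" if "j \<le> k" "i < j" for i j
    using that by (intro minor_cong eq) auto
  ultimately show ?thesis using eq by (simp add: admissible_def cong: conj_cong)
qed

context separated
begin

lemma bordering_of_admissible:
  assumes svd: "svd k B U V mu" and adm: "admissible spec sg (Suc k) B" and nu: "spec (Suc k) = nu"
  shows "bordering k mu nu eps (\<lambda>j. \<Sum>q<k. B k q * V q j) (B k k)"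
proof
  show "0 < B k k" using adm by (simp add: admissible_def)
  fix i assume "i \<le> k"
  then show "nu i - ((B k k)\<^sup>2 + (\<Sum>j<k. (\<Sum>q<k. B k q * V q j)\<^sup>2))
      - (\<Sum>j<k. mu j * (\<Sum>q<k. B k q * V q j)\<^sup>2 / (nu i - mu j)) = 0"
    using adm nu by (intro spectrum_imp_secular[OF svd]) (auto simp: admissible_def)
qed

text \<open>
  Every choice of signs is realised; the diagonal entry is then forced by the determinant.
\<close>

lemma bordering_of_signs:
  assumes "\<And>j. j < k \<Longrightarrow> \<tau> j * \<tau> j = 1"
  shows "bordering k mu nu eps (\<lambda>j. \<tau> j * sqrt (weight j / mu j)) (sqrt (gain k * nu k))"
proof
  have gk: "0 < gain k * nu k" using gain_pos[of k] nu_pos[of k] by simp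
  then show "0 < sqrt (gain k * nu k)" by simp
  define s where "s j = \<tau> j * sqrt (weight j / mu j)" for j
  have s2: "(s j)\<^sup>2 = weight j / mu j" if "j < k" for j
    using assms[OF that] weight_pos[OF that] mu_pos[OF that]
    by (simp add: s_def power_mult_distrib power2_eq_square[of "\<tau> j"])
  obtain a where a: "\<And>i. i \<le> k \<Longrightarrow> nu i - a - (\<Sum>j<k. weight j / (nu i - mu j)) = 0"
    using arrow_exists by blast
  have "a = (sqrt (gain k * nu k))\<^sup>2 + (\<Sum>j<k. (s j)\<^sup>2)"
    using secular_imp_schur[OF a] gk s2 by simp
  moreover have "(\<Sum>j<k. mu j * (s j)\<^sup>2 / (nu i - mu j)) = (\<Sum>j<k. weight j / (nu i - mu j))" for i
    using s2 mu_pos by (intro sum.cong refl) (metis lessThan_iff less_irrefl nonzero_mult_div_cancel_left times_divide_eq_right)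
  ultimately show "nu i - ((sqrt (gain k * nu k))\<^sup>2 + (\<Sum>j<k. (\<tau> j * sqrt (weight j / mu j))\<^sup>2))
      - (\<Sum>j<k. mu j * (\<tau> j * sqrt (weight j / mu j))\<^sup>2 / (nu i - mu j)) = 0" if "i \<le> k" for i
    using a[OF that] unfolding s_def by simp
qed

end

text \<open>
  The bound on \<open>x\<close> leaves room for an error that grows like \<open>k! x\<close> along the chain.
\<close>

locale separated_chain =
  fixes n :: nat and spec :: "nat \<Rightarrow> nat \<Rightarrow> real" and eps x :: real
  assumes sep: "\<And>k. k < n \<Longrightarrow> separated k (spec k) (spec (Suc k)) eps"
    and x: "0 < x" "4 ^ Suc n * eps \<le> x\<^sup>2" "fact (Suc n) * x \<le> 1 / 8"
begin

lemma err_le: assumes "k < n" shows "4 ^ (k + 2) * eps \<le> x\<^sup>2"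
proof -
  have "0 < eps" using sep[OF assms] by (simp add: separated_def)
  moreover have "(4::real) ^ (k + 2) \<le> 4 ^ Suc n" using assms by (intro power_increasing) auto
  ultimately have "4 ^ (k + 2) * eps \<le> 4 ^ Suc n * eps" by (intro mult_right_mono) auto
  then show ?thesis using x by linarith
qed

text \<open>
  One factor \<open>k + 1\<close> is the growth of the error in the next step, the other one is the number of
  terms in the sums to which that error is applied.
\<close>

lemma near_bound:
  assumes "k < n"
  shows "x \<le> fact k * x" "real (Suc k) * (real (Suc k) * (fact k * x)) \<le> 1 / 8"
proof -
  have "(1::real) \<le> fact k" by simp
  then show "x \<le> fact k * x" using x by simp
  have "real (Suc k) * (real (Suc k) * (fact k * x)) = real (Suc k) * fact (Suc k) * x" by simp
  also have "\<dots> \<le> real (Suc (Suc k)) * fact (Suc k) * x"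
    using x by (intro mult_right_mono) auto
  also have "\<dots> = fact (Suc (Suc k)) * x" by simp
  also have "\<dots> \<le> fact (Suc n) * x"
    using x assms by (intro mult_right_mono fact_mono) auto
  finally show "real (Suc k) * (real (Suc k) * (fact k * x)) \<le> 1 / 8" using x by linarith
qed

lemma near_bound': assumes "k < n" shows "real k * (fact k * x) \<le> 1 / 8"
proof -
  have f: "0 \<le> fact k * x" using x by simp
  have "real k * (fact k * x) \<le> real (Suc k) * (fact k * x)"
    using f by (intro mult_right_mono) auto
  also have "\<dots> \<le> real (Suc k) * (real (Suc k) * (fact k * x))"
    using f mult_right_mono[of 1 "real (Suc k)" "real (Suc k) * (fact k * x)"] by simp
  finally show ?thesis using near_bound(2)[OF assms] by linarith
qed

lemma admissible_structure:
  "k \<le> n \<Longrightarrow> admissible spec sg k B \<Longrightarrow>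
    \<exists>U V. svd k B U V (spec k) \<and> near_signed_perm k (fact k * x) U V"
proof (induction k)
  case 0
  then show ?case by (auto simp: svd_def ortho_def near_signed_perm_def)
next
  case (Suc k)
  then have k: "k < n" by simp
  obtain U V where svd: "svd k B U V (spec k)" and near: "near_signed_perm k (fact k * x) U V"
    using Suc admissible_SucD by auto
  have U: "ortho k U" and V: "ortho k V" using svd by (auto simp: svd_def)
  interpret separated k "spec k" "spec (Suc k)" eps by (rule sep[OF k])
  interpret bordering k "spec k" "spec (Suc k)" eps "\<lambda>j. \<Sum>q<k. B k q * V q j" "B k k"
    using svd Suc.prems(2) by (rule bordering_of_admissible) simp
  have row: "B k q = (\<Sum>j<k. (\<Sum>q<k. B k q * V q j) * V q j)" if "q < k" for q
    using ortho_row_expansion[OF V that, of "B k"] by simp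
  have "svd (Suc k) B (bordered k U X0 X) (bordered k V Y0 Y) (spec (Suc k))"
    using Suc.prems(2) by (intro svd_step[OF svd row]) (auto simp: admissible_def)
  moreover have "near_signed_perm (Suc k) (real (Suc k) * (fact k * x)) (bordered k U X0 X) (bordered k V Y0 Y)"
    using err_le[OF k] x near_bound[OF k] by (intro near_step[OF near U V]) auto
  ultimately show ?case by (auto simp: mult.assoc)
qed

text \<open>
  Two solutions agree on the smaller block by induction. The coordinates of their new rows have equal
  squares by the secular equation and equal signs by \<open>sgn_minor_step\<close>.
\<close>

lemma admissible_unique:
  "k \<le> n \<Longrightarrow> admissible spec sg k B \<Longrightarrow> admissible spec sg k B' \<Longrightarrow> p < k \<Longrightarrow> q < k \<Longrightarrow> B p q = B' p q"
proof (induction k arbitrary: p q)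
  case 0
  then show ?case by simp
next
  case (Suc k)
  then have k: "k < n" by simp
  have eq: "B p q = B' p q" if "p < k" "q < k" for p q
    using Suc.IH[of p q] Suc.prems(1-3) admissible_SucD that by auto
  obtain U V where svd: "svd k B U V (spec k)" and near: "near_signed_perm k (fact k * x) U V"
    using admissible_structure[of k sg B] k Suc.prems(2) admissible_SucD by auto
  have svd': "svd k B' U V (spec k)" using svd svd_cong[of k B B'] eq by blast
  have U: "ortho k U" and V: "ortho k V" using svd by (auto simp: svd_def)
  define s where "s j = (\<Sum>q<k. B k q * V q j)" for j
  define s' where "s' j = (\<Sum>q<k. B' k q * V q j)" for j
  have row: "B k q = (\<Sum>j<k. s j * V q j)" "B' k q = (\<Sum>j<k. s' j * V q j)" if "q < k" for q
    unfolding s_def s'_def using ortho_row_expansion[OF V that] by simp_all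
  have col: "B p k = 0" "B' p k = 0" if "p < k" for p
    using Suc.prems(2,3) that by (auto simp: admissible_def)
  interpret separated k "spec k" "spec (Suc k)" eps by (rule sep[OF k])
  interpret b: bordering k "spec k" "spec (Suc k)" eps s "B k k"
    unfolding s_def using svd Suc.prems(2) by (rule bordering_of_admissible) simp
  interpret b': bordering k "spec k" "spec (Suc k)" eps s' "B' k k"
    unfolding s'_def using svd' Suc.prems(3) by (rule bordering_of_admissible) simp
  have dd: "B k k = B' k k"
  proof -
    have "(B k k)\<^sup>2 = (B' k k)\<^sup>2" using b.d_sq b'.d_sq by simp
    then show ?thesis using b.d_pos b'.d_pos by (simp add: power2_eq_iff)
  qed
  have ss: "s m = s' m" if m: "m < k" for m
  proof -
    have "sgn (s m) * row_sign k U V m = sg (Suc m) (Suc k)"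
      using b.sgn_minor_step[OF svd near row(1) refl col(1) err_le[OF k] _ near_bound[OF k] m] x Suc.prems(2) m
      by (auto simp: admissible_def)
    moreover have "sgn (s' m) * row_sign k U V m = sg (Suc m) (Suc k)"
      using b'.sgn_minor_step[OF svd' near row(2) refl col(2) err_le[OF k] _ near_bound[OF k] m] x Suc.prems(3) m
      by (auto simp: admissible_def)
    moreover have "row_sign k U V m \<noteq> 0"
      using row_sign_square[OF near U V _ near_bound'[OF k] m] x by auto
    ultimately have "sgn (s m) = sgn (s' m)" by (metis mult_right_cancel)
    moreover have "\<bar>s m\<bar> = \<bar>s' m\<bar>" using b.s_sq[OF m] b'.s_sq[OF m] by (metis real_sqrt_abs)
    ultimately show ?thesis by (metis mult_sgn_abs)
  qed
  show ?case
  proof (cases "p = k"; cases "q = k")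
    assume "p \<noteq> k" "q \<noteq> k" then show ?thesis using eq Suc.prems by simp
  next
    assume "p \<noteq> k" "q = k" then show ?thesis using col Suc.prems by simp
  next
    assume "p = k" "q \<noteq> k" then show ?thesis using row ss Suc.prems by simp
  next
    assume "p = k" "q = k" then show ?thesis using dd by simp
  qed
qed

text \<open>
  The signs of the new coordinates are chosen as the prescribed signs of the minors times \<open>row_sign\<close>.
\<close>

lemma admissible_exists:
  assumes sg: "\<And>i j. sg i j * sg i j = 1"
  shows "k \<le> n \<Longrightarrow> \<exists>B. admissible spec sg k B"
proof (induction k)
  case 0
  then show ?case by (auto simp: admissible_def gram_spectrum_def)
next
  case (Suc k)
  then have k: "k < n" by simp
  obtain B0 where B0: "admissible spec sg k B0" using Suc by auto
  obtain U V where svd0: "svd k B0 U V (spec k)" and near: "near_signed_perm k (fact k * x) U V"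
    using admissible_structure[OF _ B0] k by auto
  have U: "ortho k U" and V: "ortho k V" using svd0 by (auto simp: svd_def)
  interpret separated k "spec k" "spec (Suc k)" eps by (rule sep[OF k])
  define \<tau> where "\<tau> m = sg (Suc m) (Suc k) * row_sign k U V m" for m
  have rs: "row_sign k U V m * row_sign k U V m = 1" if "m < k" for m
    using row_sign_square[OF near U V _ near_bound'[OF k] that] x by simp
  have mix: "(a * b) * (a * b) = (a * a) * (b * b)" for a b :: real by simp
  have \<tau>2: "\<tau> m * \<tau> m = 1" if "m < k" for m
    unfolding \<tau>_def mix[of "sg _ _"] sg rs[OF that] by simp
  define s where "s j = \<tau> j * sqrt (weight j / spec k j)" for j
  define d where "d = sqrt (gain k * spec (Suc k) k)"
  interpret b: bordering k "spec k" "spec (Suc k)" eps s d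
    unfolding s_def d_def using \<tau>2 by (rule bordering_of_signs)
  define B where "B p q = (if p < k then (if q < k then B0 p q else 0)
      else if q < k then (\<Sum>j<k. s j * V q j) else if q = k then d else 0)" for p q
  have eq: "B p q = B0 p q" if "p < k" "q < k" for p q using that by (simp add: B_def)
  have B: "admissible spec sg k B" using B0 admissible_cong[of k B B0] eq by blast
  have svd: "svd k B U V (spec k)" using svd0 svd_cong[of k B B0] eq by blast
  have row: "B k q = (\<Sum>j<k. s j * V q j)" if "q < k" for q using that by (simp add: B_def)
  have Bkk: "B k k = d" by (simp add: B_def)
  have col: "B p k = 0" if "p < k" for p using that by (simp add: B_def)
  have "svd (Suc k) B (bordered k U b.X0 b.X) (bordered k V b.Y0 b.Y) (spec (Suc k))"
    by (rule b.svd_step[OF svd row Bkk col])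
  then have spec: "gram_spectrum (Suc k) B (spec (Suc k))"
    by (rule svd_imp_gram_spectrum) (use nu_pos in \<open>auto intro: less_imp_le simp: less_Suc_eq_le\<close>)
  have signs: "sgn (minor (Suc k) i B) = sg i (Suc k)" if i: "1 \<le> i" "i < Suc k" for i
  proof -
    define m where "m = i - 1"
    have m: "m < k" "i = Suc m" using i by (auto simp: m_def)
    have "sgn (minor (Suc k) i B) = sgn (s m) * row_sign k U V m"
      unfolding m(2) using x
      by (intro b.sgn_minor_step[OF svd near row Bkk col err_le[OF k] _ near_bound[OF k] m(1)]) auto
    also have "sgn (s m) = \<tau> m"
    proof -
      have "\<tau> m = 1 \<or> \<tau> m = -1" using \<tau>2[OF m(1)] by (simp add: square_eq_1_iff)
      moreover have "0 < sqrt (weight m / spec k m)" using weight_pos[OF m(1)] mu_pos[OF m(1)] by simp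
      ultimately show ?thesis by (auto simp: s_def sgn_mult)
    qed
    also have "\<tau> m * row_sign k U V m = sg i (Suc k)"
      unfolding \<tau>_def m(2) using rs[OF m(1)] by (simp add: mult.assoc)
    finally show ?thesis .
  qed
  have "admissible spec sg (Suc k) B"
    using B Bkk b.d_pos col spec signs unfolding admissible_def
    by (auto simp: less_Suc_eq le_Suc_eq)
  then show ?case by blast
qed

end

section \<open>Ordered eigenvalues of Gram matrices\<close>

definition lower_pos :: "nat \<Rightarrow> (nat \<Rightarrow> nat \<Rightarrow> real) \<Rightarrow> bool" where
  "lower_pos k B \<longleftrightarrow> (\<forall>p<k. 0 < B p p) \<and> (\<forall>p<k. \<forall>q<k. p < q \<longrightarrow> B p q = 0)"

text \<open>
  The complex matrix that occurs as bottom right block of \<open>b b\<^sup>*\<close>, so the index order is reversed again.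
\<close>

definition gram_mat :: "nat \<Rightarrow> (nat \<Rightarrow> nat \<Rightarrow> real) \<Rightarrow> complex mat" where
  "gram_mat k B = mat k k (\<lambda>(p, q). complex_of_real (gram k B (k - 1 - p) (k - 1 - q)))"

lemma gram_mat_carrier: "gram_mat k B \<in> carrier_mat k k"
  by (simp add: gram_mat_def)

lemma eigenvalue_gram_mat_iff:
  "eigenvalue (gram_mat k B) z \<longleftrightarrow> (\<exists>y :: nat \<Rightarrow> complex. (\<exists>p<k. y p \<noteq> 0) \<and>
     (\<forall>p<k. (\<Sum>q<k. of_real (gram k B p q) * y q) = z * y p))"
proof
  assume "eigenvalue (gram_mat k B) z"
  then obtain v where v: "v \<in> carrier_vec k" "v \<noteq> 0\<^sub>v k" "gram_mat k B *\<^sub>v v = z \<cdot>\<^sub>v v"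
    by (auto simp: eigenvalue_def eigenvector_def gram_mat_def)
  define y where "y p = v $ (k - 1 - p)" for p
  obtain q where q: "q < k" "v $ q \<noteq> 0" using v(1,2) by (metis eq_vecI carrier_vecD index_zero_vec)
  then have "y (k - 1 - q) \<noteq> 0" "k - 1 - q < k" by (auto simp: y_def)
  moreover have "(\<Sum>q<k. of_real (gram k B p q) * y q) = z * y p" if p: "p < k" for p
  proof -
    have "z * y p = (gram_mat k B *\<^sub>v v) $ (k - 1 - p)" using v p by (simp add: y_def)
    also have "\<dots> = (\<Sum>q<k. of_real (gram k B p (k - 1 - q)) * v $ q)"
      using p v(1) by (simp add: gram_mat_def scalar_prod_def atLeast0LessThan)
    also have "\<dots> = (\<Sum>q<k. of_real (gram k B p (k - Suc q)) * y (k - Suc q))"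
      by (intro sum.cong refl) (simp add: y_def)
    also have "\<dots> = (\<Sum>q<k. of_real (gram k B p q) * y q)"
      by (rule sum.nat_diff_reindex[of "\<lambda>q. of_real (gram k B p q) * y q"])
    finally show ?thesis by simp
  qed
  ultimately show "\<exists>y. (\<exists>p<k. y p \<noteq> 0) \<and> (\<forall>p<k. (\<Sum>q<k. of_real (gram k B p q) * y q) = z * y p)"
    by blast
next
  assume "\<exists>y. (\<exists>p<k. y p \<noteq> 0) \<and> (\<forall>p<k. (\<Sum>q<k. of_real (gram k B p q) * y q) = z * y p)"
  then obtain y :: "nat \<Rightarrow> complex" and p0 where y: "p0 < k" "y p0 \<noteq> 0"
    "\<And>p. p < k \<Longrightarrow> (\<Sum>q<k. of_real (gram k B p q) * y q) = z * y p" by blast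
  define v where "v = vec k (\<lambda>q. y (k - 1 - q))"
  have "v $ (k - 1 - p0) \<noteq> 0" using y by (simp add: v_def)
  then have "v \<noteq> 0\<^sub>v k" using y(1) by auto
  moreover have "gram_mat k B *\<^sub>v v = z \<cdot>\<^sub>v v"
  proof (rule eq_vecI)
    fix p assume "p < dim_vec (z \<cdot>\<^sub>v v)"
    then have p: "p < k" by (simp add: v_def)
    have "(gram_mat k B *\<^sub>v v) $ p
        = (\<Sum>q<k. of_real (gram k B (k - 1 - p) (k - Suc q)) * y (k - Suc q))"
      using p by (simp add: gram_mat_def scalar_prod_def atLeast0LessThan v_def)
    also have "\<dots> = (\<Sum>q<k. of_real (gram k B (k - 1 - p) q) * y q)"
      by (rule sum.nat_diff_reindex[of "\<lambda>q. of_real (gram k B (k - 1 - p) q) * y q"])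
    also have "\<dots> = (z \<cdot>\<^sub>v v) $ p" using y(3)[of "k - 1 - p"] p by (simp add: v_def)
    finally show "(gram_mat k B *\<^sub>v v) $ p = (z \<cdot>\<^sub>v v) $ p" .
  qed (simp add: gram_mat_def v_def)
  moreover have "v \<in> carrier_vec k" by (simp add: v_def)
  ultimately show "eigenvalue (gram_mat k B) z"
    unfolding eigenvalue_def eigenvector_def carrier_matD(1)[OF gram_mat_carrier] by blast
qed

text \<open>
  If \<open>y\<close> is an eigenvector then \<open>z |y|\<^sup>2 = |B\<^sup>T y|\<^sup>2\<close>, and \<open>B\<^sup>T\<close> is injective. Positivity matters
  for \<open>L_map\<close>, where the logarithm recovers a product of eigenvalues only if it is positive.
\<close>

lemma gram_mat_eigenvalue_pos:
  assumes B: "lower_pos k B" and ev: "eigenvalue (gram_mat k B) z"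
  shows "z \<in> \<real>" "0 < Re z"
proof -
  obtain y :: "nat \<Rightarrow> complex" and p0 where y: "p0 < k" "y p0 \<noteq> 0"
    "\<And>p. p < k \<Longrightarrow> (\<Sum>q<k. of_real (gram k B p q) * y q) = z * y p"
    using ev unfolding eigenvalue_gram_mat_iff by blast
  define g where "g l = (\<Sum>q<k. of_real (B q l) * y q)" for l
  define N where "N = (\<Sum>p<k. (cmod (y p))\<^sup>2)"
  define G where "G = (\<Sum>l<k. (cmod (g l))\<^sup>2)"
  have sq: "cnj w * w = complex_of_real ((cmod w)\<^sup>2)" for w
    by (simp only: mult.commute[of "cnj w"] complex_norm_square)
  have "complex_of_real N = (\<Sum>p<k. cnj (y p) * y p)" by (simp only: N_def of_real_sum sq)
  then have "z * of_real N = (\<Sum>p<k. cnj (y p) * (z * y p))"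
    by (simp add: sum_distrib_left mult_ac)
  also have "\<dots> = (\<Sum>p<k. cnj (y p) * (\<Sum>q<k. of_real (gram k B p q) * y q))"
    using y(3) by simp
  also have "\<dots> = (\<Sum>p<k. \<Sum>q<k. \<Sum>l<k. (of_real (B p l) * cnj (y p)) * (of_real (B q l) * y q))"
    by (simp add: gram_def sum_distrib_left sum_distrib_right mult_ac)
  also have "\<dots> = (\<Sum>p<k. \<Sum>l<k. \<Sum>q<k. (of_real (B p l) * cnj (y p)) * (of_real (B q l) * y q))"
    by (intro sum.cong refl sum.swap)
  also have "\<dots> = (\<Sum>l<k. \<Sum>p<k. \<Sum>q<k. (of_real (B p l) * cnj (y p)) * (of_real (B q l) * y q))"
    by (rule sum.swap)
  also have "\<dots> = (\<Sum>l<k. cnj (g l) * g l)"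
    by (simp add: g_def sum_product)
  also have "\<dots> = of_real G" by (simp add: G_def sq)
  finally have zN: "z * of_real N = of_real G" .
  have "0 < (cmod (y p0))\<^sup>2" using y(2) by simp
  also have "\<dots> \<le> N" unfolding N_def using y(1) by (intro member_le_sum) auto
  finally have N: "0 < N" .
  \<comment> \<open>Injectivity of the upper triangular matrix: look at the last nonzero coordinate of \<open>y\<close>.\<close>
  define m where "m = Max {p. p < k \<and> y p \<noteq> 0}"
  have fin: "finite {p. p < k \<and> y p \<noteq> 0}" by simp
  have ne: "{p. p < k \<and> y p \<noteq> 0} \<noteq> {}" using y by blast
  have m: "m < k" "y m \<noteq> 0" using Max_in[OF fin ne] by (auto simp: m_def)
  have above: "y q = 0" if "m < q" "q < k" for q
    using Max_ge[OF fin, of q] that unfolding m_def[symmetric] by (metis (mono_tags, lifting) mem_Collect_eq not_le)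
  have "g m = of_real (B m m) * y m + (\<Sum>q\<in>{..<k}-{m}. of_real (B q m) * y q)"
    unfolding g_def using m by (intro sum.remove) auto
  also have "(\<Sum>q\<in>{..<k}-{m}. of_real (B q m) * y q) = 0"
  proof (rule sum.neutral, rule ballI)
    fix q assume q: "q \<in> {..<k} - {m}"
    show "of_real (B q m) * y q = 0"
      using q above[of q] B m(1) by (cases "q < m") (auto simp: lower_pos_def)
  qed
  finally have "g m = of_real (B m m) * y m" by simp
  moreover have "0 < B m m" using B m by (simp add: lower_pos_def)
  ultimately have "g m \<noteq> 0" using m(2) by auto
  then have "0 < (cmod (g m))\<^sup>2" by simp
  also have "\<dots> \<le> G" unfolding G_def using m(1) by (intro member_le_sum) auto
  finally have G: "0 < G" .
  have "z = of_real (G / N)" using zN N by (simp add: field_simps)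
  then show "z \<in> \<real>" "0 < Re z" using N G by simp_all
qed

lemma gram_spectrum_iff_eigenvalue:
  "gram_spectrum k B mu \<longleftrightarrow> (\<forall>i<k. eigenvalue (gram_mat k B) (of_real (mu i)))"
proof -
  have "(\<exists>y. (\<exists>p<k. y p \<noteq> 0) \<and> (\<forall>p<k. (\<Sum>q<k. gram k B p q * y q) = c * y p))
      \<longleftrightarrow> eigenvalue (gram_mat k B) (of_real c)" (is "?L \<longleftrightarrow> ?R") for c :: real
  proof
    assume ?L
    then obtain y where y: "\<exists>p<k. y p \<noteq> 0"
      "\<And>p. p < k \<Longrightarrow> (\<Sum>q<k. gram k B p q * y q) = c * y p" by blast
    have "(\<Sum>q<k. of_real (gram k B p q) * complex_of_real (y q)) = of_real c * of_real (y p)" if "p < k" for p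
      using y(2)[OF that] by (simp flip: of_real_mult of_real_sum)
    then show ?R unfolding eigenvalue_gram_mat_iff using y(1)
      by (intro exI[of _ "\<lambda>p. complex_of_real (y p)"]) auto
  next
    assume ?R
    then obtain y :: "nat \<Rightarrow> complex" and p0 where y: "p0 < k" "y p0 \<noteq> 0"
      "\<And>p. p < k \<Longrightarrow> (\<Sum>q<k. of_real (gram k B p q) * y q) = of_real c * y p"
      unfolding eigenvalue_gram_mat_iff by blast
    have re: "(\<Sum>q<k. gram k B p q * Re (y q)) = c * Re (y p)" if "p < k" for p
      using arg_cong[OF y(3)[OF that], of Re] by simp
    have im: "(\<Sum>q<k. gram k B p q * Im (y q)) = c * Im (y p)" if "p < k" for p
      using arg_cong[OF y(3)[OF that], of Im] by simp
    have "Re (y p0) \<noteq> 0 \<or> Im (y p0) \<noteq> 0" using y(2) by (auto simp: complex_eq_iff)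
    then show ?L
    proof
      assume "Re (y p0) \<noteq> 0"
      then show ?L using re y(1) by (intro exI[of _ "\<lambda>p. Re (y p)"]) auto
    next
      assume "Im (y p0) \<noteq> 0"
      then show ?L using im y(1) by (intro exI[of _ "\<lambda>p. Im (y p)"]) auto
    qed
  qed
  then show ?thesis by (simp add: gram_spectrum_def)
qed

lemma eigenvalues_desc_props:
  assumes "A \<in> carrier_mat k k"
  shows "length (eigenvalues_desc A) = k"
    and "x \<in> set (eigenvalues_desc A) \<longleftrightarrow> (\<exists>z. eigenvalue A z \<and> x = Re z)"
proof -
  have deg: "degree (char_poly A) = k" "char_poly A \<noteq> 0"
    using degree_monic_char_poly[OF assms] by auto
  then show "length (eigenvalues_desc A) = k"
    by (simp add: eigenvalues_desc_def size_proots_complex flip: size_mset)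
  show "x \<in> set (eigenvalues_desc A) \<longleftrightarrow> (\<exists>z. eigenvalue A z \<and> x = Re z)"
    using deg by (auto simp: eigenvalues_desc_def eigenvalue_root_char_poly[OF assms])
qed

text \<open>
  The \<open>k\<close> distinct eigenvalues exhaust the roots of the characteristic polynomial, which has degree
  \<open>k\<close>; so each of them is a simple root.
\<close>

lemma eigenvalues_desc_eqI:
  assumes A: "A \<in> carrier_mat k k" and dec: "\<And>i j. i < j \<Longrightarrow> j < k \<Longrightarrow> mu j < mu i"
    and ev: "\<And>i. i < k \<Longrightarrow> eigenvalue A (of_real (mu i))"
  shows "eigenvalues_desc A = map mu [0..<k]"
proof -
  have deg: "degree (char_poly A) = k" "char_poly A \<noteq> 0"
    using degree_monic_char_poly[OF A] by auto
  have inj: "inj_on mu {..<k}"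
    by (intro inj_onI) (metis dec lessThan_iff less_irrefl linorder_neqE_nat)
  define S where "S = (\<lambda>i. complex_of_real (mu i)) ` {..<k}"
  have S: "finite S" "card S = k"
    using inj by (auto simp: S_def inj_on_def intro!: card_image[THEN trans])
  have "mset_set S \<subseteq># proots (char_poly A)"
  proof (rule mset_subset_eqI)
    fix a
    show "count (mset_set S) a \<le> count (proots (char_poly A)) a"
    proof (cases "a \<in> S")
      case True
      then have "poly (char_poly A) a = 0"
        using ev eigenvalue_root_char_poly[OF A] by (auto simp: S_def)
      then have "1 \<le> Polynomial.order a (char_poly A)" using deg(2) by (simp add: Suc_le_eq order_gt_0_iff)
      then show ?thesis using True S(1) deg(2) by simp
    qed simp
  qed
  moreover have "size (mset_set S) = size (proots (char_poly A))"
    using S deg by (simp add: size_proots_complex)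
  ultimately have "proots (char_poly A) = mset_set S"
    by (metis mset_subset_size subset_mset.le_imp_less_or_eq less_irrefl)
  also have "mset_set S = image_mset (\<lambda>i. complex_of_real (mu i)) (mset_set {..<k})"
    unfolding S_def using inj by (intro image_mset_mset_set[symmetric]) (auto simp: inj_on_def)
  finally have "image_mset Re (proots (char_poly A)) = image_mset mu (mset_set {..<k})"
    by (simp add: multiset.map_comp o_def)
  also have "mset_set {..<k} = mset [0..<k]" by (simp add: lessThan_atLeast0)
  finally have "image_mset Re (proots (char_poly A)) = mset (rev (map mu [0..<k]))" by simp
  moreover have "sorted (rev (map mu [0..<k]))"
    by (subst sorted_wrt_rev) (auto simp: sorted_wrt_iff_nth_less intro!: less_imp_le dec)
  ultimately have "sorted_list_of_multiset (image_mset Re (proots (char_poly A))) = rev (map mu [0..<k])"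
    by (metis sorted_list_of_multiset_mset sorted_sort_id)
  then show ?thesis by (simp add: eigenvalues_desc_def)
qed

lemma gram_spectrum_iff_eigenvalues_desc:
  assumes B: "lower_pos k B" and dec: "\<And>i j. i < j \<Longrightarrow> j < k \<Longrightarrow> mu j < mu i"
  shows "gram_spectrum k B mu \<longleftrightarrow> (\<forall>i<k. eigenvalues_desc (gram_mat k B) ! i = mu i)"
proof
  assume "gram_spectrum k B mu"
  then have "eigenvalues_desc (gram_mat k B) = map mu [0..<k]"
    using dec by (intro eigenvalues_desc_eqI[OF gram_mat_carrier]) (auto simp: gram_spectrum_iff_eigenvalue)
  then show "\<forall>i<k. eigenvalues_desc (gram_mat k B) ! i = mu i" by simp
next
  assume eq: "\<forall>i<k. eigenvalues_desc (gram_mat k B) ! i = mu i"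
  show "gram_spectrum k B mu" unfolding gram_spectrum_iff_eigenvalue
  proof (intro allI impI)
    fix i assume i: "i < k"
    then have "mu i \<in> set (eigenvalues_desc (gram_mat k B))"
      using eq eigenvalues_desc_props(1)[OF gram_mat_carrier, of k B] by (metis nth_mem)
    then obtain z where z: "eigenvalue (gram_mat k B) z" "mu i = Re z"
      using eigenvalues_desc_props(2)[OF gram_mat_carrier] by blast
    then have "of_real (mu i) = z" using gram_mat_eigenvalue_pos(1)[OF B z(1)] by (simp add: complex_is_Real_iff complex_eq_iff)
    then show "eigenvalue (gram_mat k B) (of_real (mu i))" using z by simp
  qed
qed

lemma eigenvalues_desc_gram_pos:
  assumes "lower_pos k B" "i < k"
  shows "0 < eigenvalues_desc (gram_mat k B) ! i"
  using gram_mat_eigenvalue_pos(2)[OF assms(1)] eigenvalues_desc_props[OF gram_mat_carrier[of k B]] assms(2)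
  by (metis nth_mem)

section \<open>Complex matrices and the cone\<close>

definition flip_mat :: "nat \<Rightarrow> (nat \<Rightarrow> nat \<Rightarrow> real) \<Rightarrow> complex mat" where
  "flip_mat n B = mat n n (\<lambda>(i, j). complex_of_real (B (n - 1 - i) (n - 1 - j)))"

lemma flip_mat_AN_real: assumes "lower_pos n B" shows "flip_mat n B \<in> AN_real n"
  using assms
  by (auto simp: AN_real_def AN_def flip_mat_def lower_pos_def upper_triangular_def elements_mat_def)

lemma AN_real_flip_mat:
  assumes "b \<in> AN_real n" obtains B where "lower_pos n B" "b = flip_mat n B"
proof
  define B where "B p q = Re (b $$ (n - 1 - p, n - 1 - q))" for p q
  have b: "b \<in> carrier_mat n n" and ut: "upper_triangular b"
    and diag: "\<And>j. j < n \<Longrightarrow> Re (b $$ (j, j)) > 0" and el: "elements_mat b \<subseteq> \<real>"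
    using assms by (auto simp: AN_real_def AN_def)
  show "lower_pos n B"
    using b ut diag by (auto simp: lower_pos_def B_def upper_triangular_def)
  have "b $$ (i, j) = of_real (Re (b $$ (i, j)))" if "i < n" "j < n" for i j
  proof -
    have "b $$ (i, j) \<in> elements_mat b" using b that by auto
    then show ?thesis using el by (metis Reals_cases Re_complex_of_real subsetD)
  qed
  then show "b = flip_mat n B"
    using b by (intro eq_matI) (auto simp: flip_mat_def B_def)
qed

lemma pick_interval: "i < b - a \<Longrightarrow> pick {a..<b} i = a + i"
proof -
  assume i: "i < b - a"
  have "{c \<in> {a..<b}. c < a + i} = {a..<a + i}" using i by auto
  then have "card {c \<in> {a..<b}. c < a + i} = i" by simp
  then show "pick {a..<b} i = a + i"
    using pick_card_in_set[of "a + i" "{a..<b}"] i by simp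
qed

lemma submatrix_interval:
  assumes "b \<le> dim_row A" "d \<le> dim_col A"
  shows "submatrix A {a..<b} {c..<d} = mat (b - a) (d - c) (\<lambda>(i, j). A $$ (a + i, c + j))"
proof -
  have "{i. i < dim_row A \<and> i \<in> {a..<b}} = {a..<b}" "{j. j < dim_col A \<and> j \<in> {c..<d}} = {c..<d}"
    using assms by auto
  then show ?thesis unfolding submatrix_def
    by (simp only: card_atLeastLessThan) (intro cong_mat; simp add: pick_interval)
qed

lemma Delta_minor_flip_mat:
  assumes "i \<le> k" "k \<le> n"
  shows "Delta_minor i k (flip_mat n B) = of_real (minor k i B)"
proof -
  have "submatrix (flip_mat n B) {n - k..<n - k + i} {n - i..<n}
      = map_mat complex_of_real (mat i i (\<lambda>(p, q). B (k - 1 - p) (i - 1 - q)))"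
    using assms by (subst submatrix_interval) (auto simp: flip_mat_def intro!: eq_matI arg_cong2[where f = B])
  then show ?thesis
    by (simp add: Delta_minor_def minor_def flip_mat_def of_real_hom.hom_det)
qed

lemma mat_adjoint_index:
  "i < dim_col A \<Longrightarrow> j < dim_row A \<Longrightarrow> mat_adjoint A $$ (i, j) = conjugate (A $$ (j, i))"
  by (simp add: mat_adjoint_def mat_of_rows_def)

lemma bottom_right_flip_mat:
  assumes B: "lower_pos n B" and k: "k \<le> n"
  shows "bottom_right k (flip_mat n B * mat_adjoint (flip_mat n B)) = gram_mat k B"
proof -
  define b where "b = flip_mat n B"
  have b: "b \<in> carrier_mat n n" by (simp add: b_def flip_mat_def)
  have ad: "mat_adjoint b \<in> carrier_mat n n" using b by (simp add: mat_adjoint_def mat_of_rows_def)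
  have "(b * mat_adjoint b) $$ (n - k + p, n - k + q) = of_real (gram k B (k - 1 - p) (k - 1 - q))"
    if pq: "p < k" "q < k" for p q
  proof -
    have *: "n - k + p < n" "n - k + q < n" "n - Suc (n - k + p) = k - 1 - p" "n - Suc (n - k + q) = k - 1 - q"
      using pq k by auto
    have "(b * mat_adjoint b) $$ (n - k + p, n - k + q)
        = (\<Sum>l<n. b $$ (n - k + p, l) * cnj (b $$ (n - k + q, l)))"
      using b ad * by (simp add: scalar_prod_def mat_adjoint_index atLeast0LessThan conjugate_complex_def)
    also have "\<dots> = (\<Sum>l<n. complex_of_real (B (k - 1 - p) (n - Suc l) * B (k - 1 - q) (n - Suc l)))"
      using * by (intro sum.cong refl) (simp add: b_def flip_mat_def)
    also have "\<dots> = (\<Sum>l<n. complex_of_real (B (k - 1 - p) l * B (k - 1 - q) l))"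
      by (rule sum.nat_diff_reindex[of "\<lambda>l. complex_of_real (B (k - 1 - p) l * B (k - 1 - q) l)"])
    also have "\<dots> = (\<Sum>l<k. complex_of_real (B (k - 1 - p) l * B (k - 1 - q) l))"
      using B k pq by (intro sum.mono_neutral_right) (auto simp: lower_pos_def)
    finally show ?thesis by (simp add: gram_def)
  qed
  then show ?thesis
    using b ad k unfolding bottom_right_def b_def[symmetric]
    by (subst submatrix_interval) (auto simp: gram_mat_def intro!: eq_matI)
qed

text \<open>
  The products determine the single eigenvalues as successive quotients, and conversely the products
  telescope.
\<close>

lemma log_products_iff:
  fixes xs :: "nat \<Rightarrow> real"
  assumes pos: "\<And>i. i < k \<Longrightarrow> 0 < xs i" and t: "0 < t"
  shows "(\<forall>i. 1 \<le> i \<and> i \<le> k \<longrightarrow> 1 / t * ln (\<Prod>j = 1..i. xs (j - 1)) = l (i, k))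
    \<longleftrightarrow> (\<forall>i<k. xs i = exp (t * (coord l (Suc i) k - coord l i k)))"
proof -
  have eq: "(\<Prod>j = 1..i. xs (j - 1)) = (\<Prod>j<i. xs j)" for i
    by (rule prod.reindex_bij_witness[of _ Suc "\<lambda>j. j - 1"]) auto
  have ppos: "0 < (\<Prod>j<i. xs j)" if "i \<le> k" for i
    using pos that by (intro prod_pos) auto
  have "(\<forall>i. 1 \<le> i \<and> i \<le> k \<longrightarrow> 1 / t * ln (\<Prod>j<i. xs j) = l (i, k))
      \<longleftrightarrow> (\<forall>i\<le>k. (\<Prod>j<i. xs j) = exp (t * coord l i k))"
  proof -
    have "1 / t * ln (\<Prod>j<i. xs j) = l (i, k) \<longleftrightarrow> (\<Prod>j<i. xs j) = exp (t * coord l i k)"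
      if "1 \<le> i" "i \<le> k" for i
    proof -
      have "1 / t * ln (\<Prod>j<i. xs j) = l (i, k) \<longleftrightarrow> ln (\<Prod>j<i. xs j) = t * l (i, k)"
        using t by (simp add: field_simps)
      also have "\<dots> \<longleftrightarrow> (\<Prod>j<i. xs j) = exp (t * l (i, k))"
        using ppos[OF that(2)] by (metis exp_ln ln_exp)
      finally show ?thesis using that by (simp add: coord_def)
    qed
    moreover have "(\<Prod>j<0. xs j) = exp (t * coord l 0 k)" by (simp add: coord_def)
    ultimately show ?thesis by (metis One_nat_def Suc_leI not_gr0)
  qed
  also have "\<dots> \<longleftrightarrow> (\<forall>i<k. xs i = exp (t * (coord l (Suc i) k - coord l i k)))"
  proof (intro iffI allI impI)
    fix i assume P: "\<forall>i\<le>k. (\<Prod>j<i. xs j) = exp (t * coord l i k)" and i: "i < k"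
    have "exp (t * coord l (Suc i) k) = exp (t * coord l i k) * xs i"
      using P i by (metis Suc_leI less_imp_le prod.lessThan_Suc)
    then show "xs i = exp (t * (coord l (Suc i) k - coord l i k))"
      by (simp add: right_diff_distrib exp_diff)
  next
    fix i assume Q: "\<forall>i<k. xs i = exp (t * (coord l (Suc i) k - coord l i k))" and "i \<le> k"
    then show "(\<Prod>j<i. xs j) = exp (t * coord l i k)"
    proof (induction i)
      case 0
      then show ?case by (simp add: coord_def)
    next
      case (Suc i)
      then have "(\<Prod>j<Suc i. xs j) = exp (t * coord l i k) * exp (t * (coord l (Suc i) k - coord l i k))"
        by simp
      then show ?case by (simp add: right_diff_distrib flip: exp_add)
    qed
  qed
  finally show ?thesis unfolding eq .
qed

definition cone_spec :: "real \<Rightarrow> (nat \<times> nat \<Rightarrow> real) \<Rightarrow> nat \<Rightarrow> nat \<Rightarrow> real" where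
  "cone_spec t l k i = exp (t * (coord l (Suc i) k - coord l i k))"

text \<open>
  The two inequalities defining the cone say that the exponents of neighbouring eigenvalues differ by
  more than \<open>\<delta>\<close>.
\<close>

lemma C_cone_separated:
  assumes l: "l \<in> C_cone n \<delta>" and k: "k < n" and t: "0 < t" "exp (- (t * \<delta>)) \<le> eps" and eps: "eps \<le> 1 / 2"
  shows "separated k (cone_spec t l k) (cone_spec t l (Suc k)) eps"
proof
  show "0 < eps" using t(2) less_le_trans[OF exp_gt_zero] by blast
  have shift: "exp (t * a) \<le> eps * exp (t * c)" if "a + \<delta> \<le> c" for a c
  proof -
    have "t * (a + \<delta>) \<le> t * c" using that t by (intro mult_left_mono) auto
    then have "exp (t * a) \<le> exp (- (t * \<delta>) + t * c)" by (simp add: algebra_simps)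
    also have "\<dots> = exp (- (t * \<delta>)) * exp (t * c)" by (rule exp_add)
    also have "\<dots> \<le> eps * exp (t * c)" using t(2) by (intro mult_right_mono) auto
    finally show ?thesis .
  qed
  fix j assume j: "j < k"
  have "1 \<le> Suc j \<and> Suc j \<le> k \<and> k < n" using j k by simp
  then have "coord l (Suc j) (k + 1) + coord l (Suc j - 1) k > coord l (Suc j - 1) (k + 1) + coord l (Suc j) k + \<delta> \<and>
     coord l (Suc j) (k + 1) + coord l (Suc j) k > coord l (Suc j + 1) (k + 1) + coord l (Suc j - 1) k + \<delta>"
    using l unfolding C_cone_def by blast
  then have *: "(coord l (Suc j) k - coord l j k) + \<delta> \<le> coord l (Suc j) (Suc k) - coord l j (Suc k)"
    "(coord l (Suc (Suc j)) (Suc k) - coord l (Suc j) (Suc k)) + \<delta> \<le> coord l (Suc j) k - coord l j k"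
    by auto
  show "cone_spec t l k j \<le> eps * cone_spec t l (Suc k) j"
    unfolding cone_spec_def by (rule shift[OF *(1)])
  show "cone_spec t l (Suc k) (Suc j) \<le> eps * cone_spec t l k j"
    unfolding cone_spec_def by (rule shift[OF *(2)])
qed (use eps in \<open>auto simp: cone_spec_def\<close>)

lemma (in separated) nu_strict: "i < j \<Longrightarrow> j \<le> k \<Longrightarrow> nu j < nu i"
  using nu_antimono[of i j] nu_neq[of j i] by (simp add: less_le)

lemma L_map_flip_mat_iff:
  assumes B: "lower_pos n B" and t: "0 < t" and l: "l \<in> tri_space n"
    and dec: "\<And>k i j. k \<le> n \<Longrightarrow> i < j \<Longrightarrow> j < k \<Longrightarrow> cone_spec t l k j < cone_spec t l k i"
  shows "L_map n t (flip_mat n B) = l \<longleftrightarrow> (\<forall>k\<le>n. gram_spectrum k B (cone_spec t l k))"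
proof -
  define b where "b = flip_mat n B"
  have Bk: "lower_pos k B" if "k \<le> n" for k using B that by (auto simp: lower_pos_def)
  define xs where "xs k i = eigenvalues_desc (gram_mat k B) ! i" for k i
  have lam: "lam i k (b * mat_adjoint b) = xs k (i - 1)" if "k \<le> n" for i k
    unfolding lam_def b_def xs_def bottom_right_flip_mat[OF B that] ..
  have "L_map n t b = l \<longleftrightarrow> (\<forall>(i, k) \<in> tri_idx n. 1 / t * ln (\<Prod>j = 1..i. xs k (j - 1)) = l (i, k))"
  proof -
    have "L_map n t b = l \<longleftrightarrow> (\<forall>(i, k) \<in> tri_idx n. 1 / t * ln (\<Prod>j = 1..i. lam j k (b * mat_adjoint b)) = l (i, k))"
    proof
      assume "L_map n t b = l"
      then show "\<forall>(i, k) \<in> tri_idx n. 1 / t * ln (\<Prod>j = 1..i. lam j k (b * mat_adjoint b)) = l (i, k)"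
        by (auto simp: L_map_def)
    next
      assume "\<forall>(i, k) \<in> tri_idx n. 1 / t * ln (\<Prod>j = 1..i. lam j k (b * mat_adjoint b)) = l (i, k)"
      then show "L_map n t b = l"
        using l by (intro extensionalityI[of _ "tri_idx n"]) (auto simp: L_map_def tri_space_def PiE_def)
    qed
    also have "\<dots> \<longleftrightarrow> (\<forall>(i, k) \<in> tri_idx n. 1 / t * ln (\<Prod>j = 1..i. xs k (j - 1)) = l (i, k))"
      by (intro ball_cong refl) (auto simp: lam tri_idx_def)
    finally show ?thesis .
  qed
  also have "\<dots> \<longleftrightarrow> (\<forall>k\<le>n. \<forall>i. 1 \<le> i \<and> i \<le> k \<longrightarrow> 1 / t * ln (\<Prod>j = 1..i. xs k (j - 1)) = l (i, k))"
    by (auto simp: tri_idx_def)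
  also have "\<dots> \<longleftrightarrow> (\<forall>k\<le>n. \<forall>i<k. xs k i = cone_spec t l k i)"
    using eigenvalues_desc_gram_pos[OF Bk] t unfolding cone_spec_def
    by (intro all_cong1 imp_cong refl log_products_iff) (auto simp: xs_def)
  also have "\<dots> \<longleftrightarrow> (\<forall>k\<le>n. gram_spectrum k B (cone_spec t l k))"
    unfolding xs_def using gram_spectrum_iff_eigenvalues_desc[OF Bk] dec by (metis (no_types, lifting))
  finally show ?thesis unfolding b_def .
qed

lemma chamber_flip_mat_iff:
  assumes B: "lower_pos n B" and \<sigma>: "\<And>i k. (i, k) \<in> strict_tri_idx n \<Longrightarrow> \<sigma> (i, k) \<in> {-1, 1}"
  shows "flip_mat n B \<in> chamber n \<sigma> \<longleftrightarrow> (\<forall>k\<le>n. \<forall>i. 1 \<le> i \<and> i < k \<longrightarrow> sgn (minor k i B) = \<sigma> (i, k))"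
proof -
  have "Delta_minor i k (flip_mat n B) \<noteq> 0 \<and> sgn (Re (Delta_minor i k (flip_mat n B))) = \<sigma> (i, k)
      \<longleftrightarrow> sgn (minor k i B) = \<sigma> (i, k)" if "(i, k) \<in> strict_tri_idx n" for i k
  proof -
    have "i \<le> k" "k \<le> n" using that by (auto simp: strict_tri_idx_def)
    then show ?thesis using \<sigma>[OF that] by (auto simp: Delta_minor_flip_mat)
  qed
  then have "flip_mat n B \<in> chamber n \<sigma> \<longleftrightarrow> (\<forall>(i, k) \<in> strict_tri_idx n. sgn (minor k i B) = \<sigma> (i, k))"
    using flip_mat_AN_real[OF B] unfolding chamber_def by blast
  then show ?thesis by (auto simp: strict_tri_idx_def)
qed

theorem lemma6p5:
  fixes n :: nat
  assumes "n \<ge> 1"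
  shows "\<forall>\<delta>::real > 0. \<exists>t\<^sub>0::real > 0. \<forall>t \<ge> t\<^sub>0. \<forall>l \<in> C_cone n \<delta>. \<forall>K \<in> chambers n.
           \<exists>!b. b \<in> L_fiber n t l \<inter> K"
proof (intro allI impI)
  fix \<delta> :: real assume \<delta>: "0 < \<delta>"
  \<comment> \<open>\<open>x\<close> is the admissible error for \<open>X\<close> and \<open>Y\<close> in a single step, and \<open>eps\<close> achieves it because their squared errors are at most \<open>4\<^bsup>k+2\<^esup> eps\<close>, where \<open>k < n\<close>.\<close>
  define x :: real where "x = 1 / (8 * fact (Suc n))"
  define eps where "eps = min (1 / 2) (x\<^sup>2 / 4 ^ Suc n)"
  have x: "0 < x" "fact (Suc n) * x \<le> 1 / 8" by (simp_all add: x_def)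
  have eps: "0 < eps" "eps \<le> 1 / 2" using x by (simp_all add: eps_def)
  have "eps \<le> x\<^sup>2 / 4 ^ Suc n" by (simp add: eps_def)
  then have epsx: "4 ^ Suc n * eps \<le> x\<^sup>2" by (simp add: le_divide_eq mult.commute)
  define t0 where "t0 = max 1 (- ln eps / \<delta>)"
  have "\<exists>!b. b \<in> L_fiber n t l \<inter> K" if t: "t0 \<le> t" and l: "l \<in> C_cone n \<delta>" and K: "K \<in> chambers n" for t l K
  proof -
    have t1: "0 < t" "- ln eps / \<delta> \<le> t" using t by (auto simp: t0_def)
    then have "- ln eps \<le> t * \<delta>" using \<delta> by (metis pos_divide_le_eq)
    then have "exp (- (t * \<delta>)) \<le> exp (ln eps)" by simp
    then have te: "exp (- (t * \<delta>)) \<le> eps" using eps by simp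
    define spec where "spec = cone_spec t l"
    have sep: "separated k (spec k) (spec (Suc k)) eps" if "k < n" for k
      unfolding spec_def using l that t1(1) te eps(2) by (rule C_cone_separated)
    interpret separated_chain n spec eps x
      by (rule separated_chain.intro[OF sep x(1) epsx x(2)])
    have dec: "spec k j < spec k i" if kij: "k \<le> n" "i < j" "j < k" for k i j
    proof -
      obtain k' where k': "k = Suc k'" using kij by (cases k) auto
      show ?thesis using separated.nu_strict[OF sep[of k']] kij unfolding k' by simp
    qed
    have ltri: "l \<in> tri_space n" using l by (simp add: C_cone_def)
    obtain \<sigma> where \<sigma>: "K = chamber n \<sigma>" "\<sigma> \<in> strict_tri_idx n \<rightarrow>\<^sub>E {-1, 1}"
      using K by (auto simp: chambers_def)
    define sg where "sg i k = (if (i, k) \<in> strict_tri_idx n then \<sigma> (i, k) else 1)" for i k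
    have sg: "sg i k * sg i k = 1" for i k
      using PiE_mem[OF \<sigma>(2), of "(i, k)"] by (auto simp: sg_def)
    have key: "flip_mat n B \<in> L_fiber n t l \<inter> K \<longleftrightarrow> admissible spec sg n B" if B: "lower_pos n B" for B
    proof -
      have "flip_mat n B \<in> AN n" using flip_mat_AN_real[OF B] by (simp add: AN_real_def)
      then have "flip_mat n B \<in> L_fiber n t l \<longleftrightarrow> (\<forall>k\<le>n. gram_spectrum k B (spec k))"
        using L_map_flip_mat_iff[OF B t1(1) ltri dec[unfolded spec_def]] by (simp add: L_fiber_def spec_def)
      moreover have "flip_mat n B \<in> K \<longleftrightarrow> (\<forall>k\<le>n. \<forall>i. 1 \<le> i \<and> i < k \<longrightarrow> sgn (minor k i B) = sg i k)"
        using chamber_flip_mat_iff[OF B, of \<sigma>] PiE_mem[OF \<sigma>(2)] unfolding \<sigma>(1)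
        by (auto simp: sg_def strict_tri_idx_def)
      ultimately show ?thesis using B by (simp add: admissible_def lower_pos_def)
    qed
    have lower: "lower_pos n B" if "admissible spec sg n B" for B
      using that by (simp add: admissible_def lower_pos_def)
    obtain B where B: "admissible spec sg n B" using admissible_exists[of sg n, OF sg] by blast
    show ?thesis
    proof (rule ex1I[of _ "flip_mat n B"])
      show "flip_mat n B \<in> L_fiber n t l \<inter> K" using key[OF lower[OF B]] B by simp
      fix b assume b: "b \<in> L_fiber n t l \<inter> K"
      then have "b \<in> AN_real n" using \<sigma>(1) by (simp add: chamber_def)
      then obtain B' where B': "lower_pos n B'" "b = flip_mat n B'" by (rule AN_real_flip_mat)
      then have "admissible spec sg n B'" using key b by simp
      then have "B' p q = B p q" if "p < n" "q < n" for p q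
        using admissible_unique[OF order_refl] B that by blast
      then show "b = flip_mat n B"
        unfolding B'(2) flip_mat_def by (intro cong_mat) auto
    qed
  qed
  moreover have "0 < t0" by (simp add: t0_def)
  ultimately show "\<exists>t\<^sub>0>0. \<forall>t\<ge>t\<^sub>0. \<forall>l\<in>C_cone n \<delta>. \<forall>K\<in>chambers n. \<exists>!b. b \<in> L_fiber n t l \<inter> K"
    by blast
qed

end
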